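(* For any hypergraph $H$ with $R(H)=\{1,2\}$, letting $H^2$ be the graph of its $2$-edges, \[\pi(H)=\begin{cases} 2-\frac{1}{\chi(H^2)-1} & \text{if } H^2 \text{ is not bipartite};\\ \frac54 & \text{if } H^2 \text{ is bipartite and } \min\{k:\bar P_{2k}\subseteq H\}=1;\\ \frac98 & \text{if } H^2 \text{ is bipartite and } \min\{k:\bar P_{2k}\subseteq H\}\ge 2;\\ 1 & \text{if } H^2 \text{ is bipartite and } \bar P_{2k}\not\subseteq H \text{ for every } k\ge1.\end{cases}\]
   Context: A hypergraph $H=(V,E)$ has finite vertex set $V$ and edge set $E\subseteq 2^V$; $R(H)=\{|F|:F\in E\}$. $H_1\subseteq H_2$ (subgraph) means there is an injective $f\colon V(H_1)\to V(H_2)$ with $f(F)\in E(H_2)$ for all $F\in E(H_1)$. For $G$ on $n$ vertices, $h_n(G)=\sum_{F\in E(G)}1/\binom{n}{|F|}$; $\pi_n(H)=\max\{h_n(G): G\text{ on } n \text{ vertices}, R(G)\subseteq R(H), H\not\subseteq G\}$ and $\pi(H)=\lim_n\pi_n(H)$. $\chi$ denotes chromatic number. A closed path of length $m$, $\bar P_m$, is the hypergraph with vertices $x_1,\dots,x_m$, $1$-edges $\{x_1\},\{x_m\}$ and $2$-edges $\{x_i,x_{i+1}\}$, $1\le i\le m-1$. *)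

theory Defs
  imports Complex_Main
begin

definition hypergraph :: "'a set \<Rightarrow> 'a set set \<Rightarrow> bool" where
  "hypergraph V E \<longleftrightarrow> finite V \<and> E \<subseteq> Pow V"

definition edge_sizes :: "'a set set \<Rightarrow> nat set" where
  "edge_sizes E = card ` E"

definition subhypergraph :: "'a set \<Rightarrow> 'a set set \<Rightarrow> 'b set \<Rightarrow> 'b set set \<Rightarrow> bool" where
  "subhypergraph V1 E1 V2 E2 \<longleftrightarrow>
     (\<exists>f. inj_on f V1 \<and> f ` V1 \<subseteq> V2 \<and> (\<forall>F\<in>E1. f ` F \<in> E2))"

definition hdens :: "nat \<Rightarrow> nat set set \<Rightarrow> real" where
  "hdens n E = (\<Sum>F\<in>E. 1 / real (n choose card F))"

definition pi_n :: "nat \<Rightarrow> 'a set \<Rightarrow> 'a set set \<Rightarrow> real" where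
  "pi_n n V E = Max {hdens n G | G. G \<subseteq> Pow {0..<n} \<and> edge_sizes G \<subseteq> edge_sizes E
                                 \<and> \<not> subhypergraph V E {0..<n} G}"

definition chromatic_number2 :: "'a set \<Rightarrow> 'a set set \<Rightarrow> nat" where
  "chromatic_number2 V E = (LEAST k. \<exists>c :: 'a \<Rightarrow> nat. (\<forall>x\<in>V. c x < k) \<and>
       (\<forall>F\<in>E. card F = 2 \<longrightarrow> (\<forall>x\<in>F. \<forall>y\<in>F. x \<noteq> y \<longrightarrow> c x \<noteq> c y)))"

definition bipartite2 :: "'a set \<Rightarrow> 'a set set \<Rightarrow> bool" where
  "bipartite2 V E \<longleftrightarrow> (\<exists>c :: 'a \<Rightarrow> bool.
       \<forall>F\<in>E. card F = 2 \<longrightarrow> (\<forall>x\<in>F. \<forall>y\<in>F. x \<noteq> y \<longrightarrow> c x \<noteq> c y))"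

text \<open>Closed path of length m on vertices 0..m-1 (x_i = i-1): 1-edges {0}, {m-1},
  2-edges {i, i+1} for i+1 < m.\<close>
definition closed_path_V :: "nat \<Rightarrow> nat set" where
  "closed_path_V m = {0..<m}"

definition closed_path_E :: "nat \<Rightarrow> nat set set" where
  "closed_path_E m = {{0}, {m - 1}} \<union> {{i, Suc i} | i. Suc i < m}"

end

theory Submission
  imports Defs
begin

text \<open>
  Let \<open>A\<close> be the set of 1-edges of a hypergraph \<open>G\<close> on \<open>n\<close> vertices, and
  \<open>\<alpha> = |A| / n\<close>. If \<open>H\<^sup>2\<close> is \<open>(r+1)\<close>-colourable and \<open>G\<close> avoids \<open>H\<close>, then by Erdos--Stone the
  2-edges inside \<open>A\<close> have density at most \<open>1 - 1/r + o(1)\<close>, so that the density of \<open>G\<close> is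
  at most \<open>\<alpha> + 1 - \<alpha>\<^sup>2 / r + o(1)\<close>. For \<open>r \<ge> 2\<close> this is largest at \<open>\<alpha> = 1\<close>, for \<open>r = 1\<close> at
  \<open>\<alpha> = 1/2\<close>.

  If \<open>H\<^sup>2\<close> is bipartite and no 2-edge joins two 1-edges, then \<open>H\<close> lies in a blow-up of the closed
  path of length 4. Hence \<open>A\<close> is sparse, and so is the set \<open>N\<close> of the vertices outside \<open>A\<close> with
  linearly many neighbours in \<open>A\<close>, while the rest sends few edges to \<open>A\<close>. Optimising the sizes
  of these three sets gives \<open>9/8\<close>. If \<open>H\<close> has no even closed path at all, then \<open>H\<^sup>2\<close> has a
  2-colouring with all 1-edges in one class, and then only few edges of \<open>G\<close> can meet \<open>A\<close>.

  The matching constructions are the Turan graph with all 1-edges; all pairs not inside a half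
  \<open>A\<close>; the complete bipartite graph between \<open>A\<close> with \<open>|A| = 3n/4\<close> and its complement; and all
  1-edges alone.
\<close>

section \<open>Complete multipartite subgraphs of dense graphs\<close>

definition pair_count :: "('a \<Rightarrow> 'b \<Rightarrow> bool) \<Rightarrow> 'a set \<Rightarrow> 'b set \<Rightarrow> nat" where
  "pair_count R X Y = (\<Sum>x\<in>X. card {y\<in>Y. R x y})"

lemma pair_count_swap:
  assumes "finite X" "finite Y"
  shows "pair_count R X Y = (\<Sum>y\<in>Y. card {x\<in>X. R x y})"
proof -
  have *: "card {y\<in>B. P y} = (\<Sum>y\<in>B. if P y then 1 else 0)" if "finite B"
    for B :: "'c set" and P
    using that by (simp add: sum.If_cases Int_def)
  show ?thesis
    unfolding pair_count_def *[OF assms(1)] *[OF assms(2)] by (rule sum.swap)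
qed

lemma pair_count_sym:
  assumes "finite X" "finite Y" "symp R"
  shows "pair_count R X Y = pair_count R Y X"
proof -
  have "R x y = R y x" for x y
    using assms(3) by (auto dest: sympD)
  then show ?thesis
    unfolding pair_count_swap[OF assms(1,2)] by (subst pair_count_def) presburger
qed

lemma pair_count_le:
  assumes "finite Y"
  shows "pair_count R X Y \<le> card X * card Y"
  unfolding pair_count_def
  using sum_bounded_above[of X "\<lambda>x. card {y\<in>Y. R x y}" "card Y"] assms
  by (simp add: card_mono)

lemma pair_count_union_left:
  assumes "finite X" "finite X'" "X \<inter> X' = {}"
  shows "pair_count R (X \<union> X') Y = pair_count R X Y + pair_count R X' Y"
  unfolding pair_count_def using assms by (rule sum.union_disjoint)

lemma pair_count_union_right:
  assumes "finite Y" "finite Y'" "Y \<inter> Y' = {}"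
  shows "pair_count R X (Y \<union> Y') = pair_count R X Y + pair_count R X Y'"
proof -
  have "card {y \<in> Y \<union> Y'. R x y} = card {y\<in>Y. R x y} + card {y\<in>Y'. R x y}" for x
  proof -
    have "{y \<in> Y \<union> Y'. R x y} = {y\<in>Y. R x y} \<union> {y\<in>Y'. R x y}" by auto
    then show ?thesis using assms by (simp add: card_Un_disjoint disjoint_iff)
  qed
  then show ?thesis by (simp add: pair_count_def sum.distrib)
qed

text \<open>A vertex of \<open>Y\<close> with fewer than \<open>t\<close> neighbours in some class
  has fewer than \<open>(card I - 1) * T + t\<close> neighbours in all classes together. The density
  hypothesis exceeds this on average, so linearly many vertices of \<open>Y\<close> have
  \<open>t\<close> neighbours in every class. There are only boundedly many possible neighbourhoods
  in the union of the classes, so \<open>t\<close> of these vertices share one. The density is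
  measured against \<open>n\<close>, not \<open>card Y\<close>, so that one threshold serves all
  smaller sets \<open>Y\<close>.\<close>

lemma extend_complete_multipartite:
  fixes V :: "'i \<Rightarrow> 'a set" and Y :: "'b set" and \<epsilon> :: real and n t T :: nat
  assumes I: "finite I" and In: "I \<noteq> {}" and V: "\<And>i. i \<in> I \<Longrightarrow> finite (V i) \<and> card (V i) = T"
    and Y: "finite Y" "card Y \<le> n"
    and dens: "(real (card I) - 1 + \<epsilon>) * real T * real n \<le> (\<Sum>i\<in>I. real (pair_count R (V i) Y))"
    and t: "1 \<le> t" and T: "2 * real t \<le> \<epsilon> * real T"
    and n: "2 * real t * 2 ^ (card I * T) \<le> \<epsilon> * real n"
  shows "\<exists>Y' W. Y' \<subseteq> Y \<and> card Y' = t \<and>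
           (\<forall>i\<in>I. W i \<subseteq> V i \<and> card (W i) = t \<and> (\<forall>x\<in>W i. \<forall>y\<in>Y'. R x y))"
proof -
  define N where "N i y = {x\<in>V i. R x y}" for i y
  define Good where "Good = {y\<in>Y. \<forall>i\<in>I. t \<le> card (N i y)}"
  define U where "U = (\<Union>i\<in>I. V i)"
  have finN: "finite (N i y)" if "i \<in> I" for i y
    using V[OF that] by (auto simp: N_def)
  have NT: "card (N i y) \<le> T" if "i \<in> I" for i y
    using V[OF that] card_mono[of "V i" "N i y"] by (auto simp: N_def)
  have Tpos: "real T > 0"
    using T t by (cases "T = 0") auto
  \<comment> \<open>A good vertex may see everything; a bad one sees fewer than \<open>t\<close>
    vertices of one class and at most \<open>T\<close> of each other class.\<close>
  have deg: "(\<Sum>i\<in>I. real (card (N i y))) \<le>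
      (real (card I) - 1) * T + t + (if y \<in> Good then real T else 0)" if y: "y \<in> Y" for y
  proof (cases "y \<in> Good")
    case True
    have "(\<Sum>i\<in>I. real (card (N i y))) \<le> (\<Sum>i\<in>I. real T)"
      by (rule sum_mono) (use NT in auto)
    then show ?thesis using True by (simp add: algebra_simps)
  next
    case False
    then obtain j where j: "j \<in> I" "card (N j y) < t"
      using y by (auto simp: Good_def not_le)
    have "(\<Sum>i\<in>I. real (card (N i y))) = card (N j y) + (\<Sum>i\<in>I-{j}. real (card (N i y)))"
      using I j by (simp add: sum.remove)
    also have "(\<Sum>i\<in>I-{j}. real (card (N i y))) \<le> (\<Sum>i\<in>I-{j}. real T)"
      by (rule sum_mono) (use NT in auto)
    also have "\<dots> = (real (card I) - 1) * T"
      using I j card_gt_0_iff[of I] by (auto simp: of_nat_diff)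
    finally show ?thesis using False j by simp
  qed
  have "(\<Sum>i\<in>I. real (pair_count R (V i) Y)) = (\<Sum>i\<in>I. \<Sum>y\<in>Y. real (card (N i y)))"
    using V Y by (simp add: pair_count_swap N_def)
  also have "\<dots> = (\<Sum>y\<in>Y. \<Sum>i\<in>I. real (card (N i y)))"
    by (rule sum.swap)
  also have "\<dots> \<le> (\<Sum>y\<in>Y. (real (card I) - 1) * T + t + (if y \<in> Good then real T else 0))"
    by (rule sum_mono) (rule deg)
  also have "\<dots> = card Y * ((real (card I) - 1) * T + t) + card Good * T"
  proof -
    have "Y \<inter> {y. y \<in> Good} = Good" by (auto simp: Good_def)
    then show ?thesis
      using Y by (simp add: sum.distrib sum.If_cases)
  qed
  finally have up: "(\<Sum>i\<in>I. real (pair_count R (V i) Y)) \<le>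
     card Y * ((real (card I) - 1) * T + t) + card Good * T" .
  have "(real (card I) - 1 + \<epsilon>) * real T * real n \<le>
      real n * ((real (card I) - 1) * T + t) + card Good * real T"
  proof -
    have "real (card Y) * ((real (card I) - 1) * T + t) \<le> real n * ((real (card I) - 1) * T + t)"
      using Y(2) I In card_gt_0_iff[of I] by (intro mult_right_mono) (auto simp: Suc_le_eq)
    then show ?thesis using up dens by simp
  qed
  then have "real n * (\<epsilon> * real T - t) \<le> card Good * real T"
    by (simp add: algebra_simps)
  \<comment> \<open>Since \<open>T\<close> is large compared with \<open>t\<close>, the loss of
    \<open>t\<close> per bad vertex costs at most half of the excess
    \<open>\<epsilon> * T\<close>.\<close>
  moreover have "real n * (\<epsilon> * real T / 2) \<le> real n * (\<epsilon> * real T - t)"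
    using T by (intro mult_left_mono) auto
  ultimately have "(real n * \<epsilon> / 2) * real T \<le> card Good * real T"
    by (simp add: algebra_simps)
  then have "real n * \<epsilon> / 2 \<le> card Good"
    using Tpos by simp
  then have cG: "real t * 2 ^ (card I * T) \<le> card Good"
    using n by (simp add: algebra_simps)
  have finU: "finite U" using I V by (auto simp: U_def)
  have cU: "card U \<le> card I * T"
    using card_UN_le[OF I, of V] V by (simp add: U_def)
  define fib where "fib W = {y\<in>Good. {x\<in>U. R x y} = W}" for W
  \<comment> \<open>Pigeonhole over the at most \<open>2 ^ (card I * T)\<close> traces of
    neighbourhoods on \<open>U\<close>.\<close>
  have "\<exists>W\<in>Pow U. t \<le> card (fib W)"
  proof (rule ccontr)
    assume no: "\<not> ?thesis"
    have *: "card (fib W) \<le> t - 1" if W: "W \<in> Pow U" for W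
    proof -
      have "\<not> t \<le> card (fib W)" using no W by blast
      then show ?thesis by linarith
    qed
    have sub: "Good \<subseteq> (\<Union>W\<in>Pow U. fib W)"
    proof
      fix y assume "y \<in> Good"
      then show "y \<in> (\<Union>W\<in>Pow U. fib W)"
        by (intro UN_I[of "{x\<in>U. R x y}"]) (auto simp: fib_def)
    qed
    have "finite (\<Union>W\<in>Pow U. fib W)"
      using finU Y(1) by (auto simp: fib_def Good_def)
    then have "card Good \<le> card (\<Union>W\<in>Pow U. fib W)"
      using sub by (rule card_mono)
    also have "\<dots> \<le> (\<Sum>W\<in>Pow U. card (fib W))"
      using finU by (intro card_UN_le) simp
    also have "\<dots> \<le> card (Pow U) * (t - 1)"
      using sum_bounded_above[of "Pow U" "\<lambda>W. card (fib W)" "t - 1"] * by simp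
    also have "\<dots> = 2 ^ card U * (t - 1)"
      using finU by (simp add: card_Pow)
    also have "\<dots> \<le> 2 ^ (card I * T) * (t - 1)"
      using cU by (intro mult_right_mono power_increasing) auto
    also have "\<dots> < 2 ^ (card I * T) * t"
      using t by simp
    finally have "real (card Good) < real (2 ^ (card I * T) * t)"
      by (simp only: of_nat_less_iff)
    then show False using cG by (simp add: algebra_simps)
  qed
  then obtain W where W: "W \<subseteq> U" "t \<le> card (fib W)" by auto
  obtain Y' where Y': "Y' \<subseteq> fib W" "card Y' = t"
    using obtain_subset_with_card_n[OF W(2)] by blast
  \<comment> \<open>All of \<open>Y'\<close> has the same neighbourhood in \<open>U\<close> as
    \<open>y0\<close>, so any \<open>t\<close> neighbours of \<open>y0\<close> in each class are
    joined to the whole of \<open>Y'\<close>.\<close>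
  obtain y0 where y0: "y0 \<in> Y'" using Y'(2) t by fastforce
  have "\<exists>w. w \<subseteq> N i y0 \<and> card w = t" if "i \<in> I" for i
  proof -
    have "t \<le> card (N i y0)" using that y0 Y'(1) by (auto simp: fib_def Good_def)
    then show ?thesis by (meson obtain_subset_with_card_n)
  qed
  then obtain w where w: "\<And>i. i \<in> I \<Longrightarrow> w i \<subseteq> N i y0 \<and> card (w i) = t" by metis
  have "R x y" if "i \<in> I" "x \<in> w i" "y \<in> Y'" for i x y
  proof -
    have "x \<in> {x\<in>U. R x y0}" using w that by (auto simp: N_def U_def)
    also have "\<dots> = {x\<in>U. R x y}" using that y0 Y' by (auto simp: fib_def)
    finally show ?thesis by simp
  qed
  moreover have "Y' \<subseteq> Y" using Y' by (auto simp: fib_def Good_def)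
  ultimately show ?thesis
    using w Y'(2) by (intro exI[of _ Y'] exI[of _ w]) (fastforce simp: N_def)
qed

text \<open>This is the extension step for a single class \<open>S\<close>, where the main term
  \<open>card I - 1\<close> vanishes and any positive density suffices.\<close>

lemma high_degree_common_neighbours:
  fixes \<epsilon> :: real and n t T :: nat
  assumes "finite S" "card S = T" "finite Y" "card Y \<le> n"
    and deg: "\<And>x. x \<in> S \<Longrightarrow> \<epsilon> * real n \<le> card {y\<in>Y. R x y}"
    and t: "1 \<le> t" and T: "2 * real t \<le> \<epsilon> * real T"
    and n: "2 * real t * 2 ^ T \<le> \<epsilon> * real n"
  shows "\<exists>S' Y'. S' \<subseteq> S \<and> card S' = t \<and> Y' \<subseteq> Y \<and> card Y' = t \<and> (\<forall>x\<in>S'. \<forall>y\<in>Y'. R x y)"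
proof -
  have "(\<Sum>x\<in>S. \<epsilon> * real n) \<le> (\<Sum>x\<in>S. real (card {y\<in>Y. R x y}))"
    by (rule sum_mono) (rule deg)
  then have "\<epsilon> * real T * real n \<le> real (pair_count R S Y)"
    using assms(2) by (simp add: pair_count_def algebra_simps)
  then have "\<exists>Y' W. Y' \<subseteq> Y \<and> card Y' = t \<and>
     (\<forall>i\<in>{()}. W i \<subseteq> S \<and> card (W i) = t \<and> (\<forall>x\<in>W i. \<forall>y\<in>Y'. R x y))"
    by (intro extend_complete_multipartite[where n = n and T = T and \<epsilon> = \<epsilon>]) (use assms in auto)
  then show ?thesis by (metis singletonI)
qed

lemma eventually_nat_ge_real: "\<forall>\<^sub>F n in sequentially. (C::real) \<le> c * real n" if "c > 0"
proof -
  have "\<forall>\<^sub>F n in sequentially. C / c \<le> real n"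
    using eventually_ge_at_top[of "nat \<lceil>C / c\<rceil>"] by eventually_elim linarith
  then show ?thesis using that by (simp add: field_simps)
qed

text \<open>A qualitative Kovari-Sos-Turan theorem. Vertices of degree below
  \<open>\<eta>/2 * n\<close> account for at most half of the pairs, so linearly many vertices of
  \<open>X\<close> have linear degree into \<open>Y\<close>. A bounded number \<open>T\<close> of
  them already has enough common neighbours.\<close>

lemma dense_pair_complete_bipartite:
  fixes \<eta> :: real and t :: nat
  assumes "\<eta> > 0" "1 \<le> t"
  shows "\<forall>\<^sub>F n in sequentially. \<forall>X Y. \<forall>R :: 'a \<Rightarrow> 'b \<Rightarrow> bool.
    finite X \<and> finite Y \<and> card X \<le> n \<and> card Y \<le> n \<and> \<eta> * real n ^ 2 \<le> pair_count R X Y \<longrightarrow>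
    (\<exists>X' Y'. X' \<subseteq> X \<and> card X' = t \<and> Y' \<subseteq> Y \<and> card Y' = t \<and> (\<forall>x\<in>X'. \<forall>y\<in>Y'. R x y))"
proof -
  obtain T :: nat where T: "2 * real t \<le> \<eta> / 2 * real T"
    using eventually_nat_ge_real[of "\<eta>/2" "2 * real t"] assms(1) eventually_sequentially by auto
  have "\<forall>\<^sub>F n in sequentially. real T \<le> \<eta>/2 * real n"
       "\<forall>\<^sub>F n in sequentially. 2 * real t * 2 ^ T \<le> \<eta>/2 * real n"
       "\<forall>\<^sub>F n in sequentially. 1 \<le> 1 * real n"
    using assms by (intro eventually_nat_ge_real; simp)+
  then show ?thesis
  proof eventually_elim
    case (elim n)
    show ?case
    proof (intro allI impI, elim conjE)
      fix X Y and R :: "'a \<Rightarrow> 'b \<Rightarrow> bool"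
      assume fin: "finite X" "finite Y" and c: "card X \<le> n" "card Y \<le> n"
        and dens: "\<eta> * real n ^ 2 \<le> pair_count R X Y"
      define D where "D x = real (card {y\<in>Y. R x y})" for x
      define X1 where "X1 = {x\<in>X. \<eta>/2 * real n \<le> D x}"
      have Dn: "D x \<le> n" for x
        unfolding D_def using card_mono[of Y "{y\<in>Y. R x y}"] fin c by simp
      have "real (pair_count R X Y) = (\<Sum>x\<in>X. D x)"
        by (simp add: pair_count_def D_def)
      also have "\<dots> \<le> (\<Sum>x\<in>X. \<eta>/2 * real n + (if x \<in> X1 then real n else 0))"
      proof (rule sum_mono)
        fix x assume "x \<in> X"
        then show "D x \<le> \<eta>/2 * real n + (if x \<in> X1 then real n else 0)"
          using Dn[of x] assms(1) by (auto simp: X1_def intro: add_increasing)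
      qed
      also have "\<dots> = card X * (\<eta>/2 * real n) + card X1 * real n"
      proof -
        have "X \<inter> {x. x \<in> X1} = X1" by (auto simp: X1_def)
        then show ?thesis using fin by (simp add: sum.distrib sum.If_cases)
      qed
      also have "\<dots> \<le> n * (\<eta>/2 * real n) + card X1 * real n"
        using c assms(1) by (intro add_right_mono mult_right_mono) auto
      finally have "(\<eta>/2 * real n) * real n \<le> card X1 * real n"
        using dens by (simp add: power2_eq_square algebra_simps)
      then have "\<eta>/2 * real n \<le> card X1"
        using elim by (simp add: mult_le_cancel_right)
      then have "T \<le> card X1" using elim by linarith
      then obtain S where S: "S \<subseteq> X1" "card S = T"
        using obtain_subset_with_card_n by blast
      have "finite S" using S fin finite_subset by (fastforce simp: X1_def)
      then obtain S' Y' where SY: "S' \<subseteq> S" "card S' = t" "Y' \<subseteq> Y" "card Y' = t" "\<forall>x\<in>S'. \<forall>y\<in>Y'. R x y"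
        by (atomize_elim, intro high_degree_common_neighbours[where \<epsilon> = "\<eta>/2" and n = n and T = T])
           (use S fin c T elim assms in \<open>auto simp: X1_def D_def\<close>)
      then show "\<exists>X' Y'. X' \<subseteq> X \<and> card X' = t \<and> Y' \<subseteq> Y \<and> card Y' = t \<and> (\<forall>x\<in>X'. \<forall>y\<in>Y'. R x y)"
        using S(1) by (intro exI[of _ S'] exI[of _ Y']) (auto simp: X1_def)
    qed
  qed
qed

section \<open>The Erdos-Stone theorem\<close>

definition complete_parts :: "('a \<Rightarrow> 'a \<Rightarrow> bool) \<Rightarrow> 'a set \<Rightarrow> nat \<Rightarrow> nat \<Rightarrow> (nat \<Rightarrow> 'a set) \<Rightarrow> bool" where
  "complete_parts R S r t P \<longleftrightarrow> (\<forall>i<r. P i \<subseteq> S \<and> card (P i) = t) \<and>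
     (\<forall>i<r. \<forall>j<r. i \<noteq> j \<longrightarrow> (\<forall>x\<in>P i. \<forall>y\<in>P j. R x y))"

text \<open>The usual degree condition \<open>1 - 1/r + \<epsilon>/r\<close> is multiplied by
  \<open>r\<close>, so that the induction can start at \<open>r = 0\<close>, where a single part is
  wanted. In the step the induction hypothesis yields one part fewer, but with parts of a larger
  size \<open>T\<close>; the degree condition then provides a further part, while the old ones
  shrink from \<open>T\<close> to \<open>t\<close>.\<close>

lemma Erdos_Stone_min_degree:
  fixes \<epsilon> :: real
  assumes "\<epsilon> > 0" "1 \<le> t"
  shows "\<exists>n0. \<forall>S. \<forall>R :: 'a \<Rightarrow> 'a \<Rightarrow> bool. finite S \<and> n0 \<le> card S \<and> symp R \<and>
    (\<forall>v\<in>S. (real r - 1 + \<epsilon>) * card S \<le> real r * card {w\<in>S. R v w}) \<longrightarrow>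
    (\<exists>P. complete_parts R S (Suc r) t P)"
  using assms
proof (induction r arbitrary: t \<epsilon>)
  case 0
  show ?case
  proof (intro exI[of _ t] allI impI, elim conjE)
    fix S :: "'a set" and R
    assume "t \<le> card S"
    then obtain T where "T \<subseteq> S" "card T = t" using obtain_subset_with_card_n by blast
    then show "\<exists>P. complete_parts R S (Suc 0) t P"
      by (intro exI[of _ "\<lambda>_. T"]) (auto simp: complete_parts_def)
  qed
next
  case (Suc r)
  obtain T0 :: nat where T0: "2 * real t \<le> \<epsilon> * real T0"
    using eventually_nat_ge_real[of \<epsilon> "2 * real t"] Suc.prems eventually_sequentially by auto
  \<comment> \<open>The induction hypothesis asks for parts of size at least 1.\<close>
  define T where "T = max 1 T0"
  have "\<epsilon> * real T0 \<le> \<epsilon> * real T"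
    using Suc.prems by (intro mult_left_mono) (auto simp: T_def)
  then have T: "2 * real t \<le> \<epsilon> * real T" "1 \<le> T"
    using T0 by (auto simp: T_def)
  \<comment> \<open>The slack \<open>1 / (r + 1)\<close> is what the relative degree
    \<open>r / (r + 1)\<close> leaves above the threshold one level lower:
    \<open>r * r / (r + 1) = r - 1 + 1 / (r + 1)\<close>.\<close>
  obtain n0 where n0: "\<And>S. \<And>R :: 'a \<Rightarrow> 'a \<Rightarrow> bool. finite S \<Longrightarrow> n0 \<le> card S \<Longrightarrow> symp R \<Longrightarrow>
    (\<And>v. v\<in>S \<Longrightarrow> (real r - 1 + 1 / (real r + 1)) * card S \<le> real r * card {w\<in>S. R v w}) \<Longrightarrow>
    \<exists>P. complete_parts R S (Suc r) T P"
  proof -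
    obtain n0 where "\<forall>S. \<forall>R :: 'a \<Rightarrow> 'a \<Rightarrow> bool. finite S \<and> n0 \<le> card S \<and> symp R \<and>
      (\<forall>v\<in>S. (real r - 1 + 1 / (real r + 1)) * card S \<le> real r * card {w\<in>S. R v w}) \<longrightarrow>
      (\<exists>P. complete_parts R S (Suc r) T P)"
      using Suc.IH[of "1 / (real r + 1)" T] T(2) by auto
    then show ?thesis by (intro that[of n0]) blast
  qed
  obtain n1 where n1: "\<And>n. n \<ge> n1 \<Longrightarrow> 2 * real t * 2 ^ (Suc r * T) \<le> \<epsilon> * real n"
    using eventually_nat_ge_real[of \<epsilon> "2 * real t * 2 ^ (Suc r * T)"] Suc.prems
    by (auto simp: eventually_sequentially)
  show ?case
  proof (intro exI[of _ "max n0 n1"] allI impI, elim conjE)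
    fix S :: "'a set" and R
    assume S: "finite S" "max n0 n1 \<le> card S" "symp R"
      and deg: "\<forall>v\<in>S. (real (Suc r) - 1 + \<epsilon>) * card S \<le> real (Suc r) * card {w\<in>S. R v w}"
    have deg': "(real r + \<epsilon>) / (real r + 1) * card S \<le> card {w\<in>S. R v w}" if "v \<in> S" for v
      using deg that by (simp add: field_simps)
    have "(real r - 1 + 1 / (real r + 1)) * card S \<le> real r * card {w\<in>S. R v w}" if "v \<in> S" for v
    proof -
      have "(real r - 1 + 1 / (real r + 1)) * card S = real r * (real r / (real r + 1) * card S)"
        by (simp add: field_simps)
      also have "\<dots> \<le> real r * ((real r + \<epsilon>) / (real r + 1) * card S)"
        using Suc.prems by (intro mult_left_mono mult_right_mono divide_right_mono) auto
      also have "\<dots> \<le> real r * card {w\<in>S. R v w}"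
        using deg'[OF that] by (rule mult_left_mono) simp
      finally show ?thesis .
    qed
    then obtain V where V: "complete_parts R S (Suc r) T V"
      using n0[of S R] S by auto
    have VS: "V i \<subseteq> S" "card (V i) = T" "finite (V i)" if "i < Suc r" for i
      using V that S finite_subset by (auto simp: complete_parts_def)
    have pc: "(real r + \<epsilon>) / (real r + 1) * card S * T \<le> real (pair_count R (V i) S)" if "i < Suc r" for i
    proof -
      have "(\<Sum>x\<in>V i. (real r + \<epsilon>) / (real r + 1) * card S) \<le> (\<Sum>x\<in>V i. real (card {w\<in>S. R x w}))"
        by (rule sum_mono) (use deg' VS that in auto)
      then show ?thesis using VS that by (simp add: pair_count_def algebra_simps)
    qed
    \<comment> \<open>Summed over the \<open>r + 1\<close> classes, the denominator cancels and
      leaves \<open>r + \<epsilon>\<close>, the density wanted for extending \<open>r + 1\<close>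
      classes.\<close>
    have "(\<Sum>i<Suc r. (real r + \<epsilon>) / (real r + 1) * card S * T) \<le> (\<Sum>i<Suc r. real (pair_count R (V i) S))"
      by (rule sum_mono) (use pc in auto)
    moreover have "(\<Sum>i<Suc r. (real r + \<epsilon>) / (real r + 1) * card S * T) = (real r + \<epsilon>) * T * card S"
      by (simp add: field_simps)
    ultimately have dens: "(real (card {..<Suc r}) - 1 + \<epsilon>) * T * card S \<le> (\<Sum>i\<in>{..<Suc r}. real (pair_count R (V i) S))"
      by simp
    have "\<exists>Y' W. Y' \<subseteq> S \<and> card Y' = t \<and>
           (\<forall>i\<in>{..<Suc r}. W i \<subseteq> V i \<and> card (W i) = t \<and> (\<forall>x\<in>W i. \<forall>y\<in>Y'. R x y))"
      by (rule extend_complete_multipartite[OF _ _ _ _ _ dens])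
         (use VS S Suc.prems T n1[of "card S"] in auto)
    then obtain Y' W where Y': "Y' \<subseteq> S" "card Y' = t"
      and W: "\<And>i. i < Suc r \<Longrightarrow> W i \<subseteq> V i \<and> card (W i) = t \<and> (\<forall>x\<in>W i. \<forall>y\<in>Y'. R x y)"
      by (metis lessThan_iff)
    define P where "P = W(Suc r := Y')"
    have R: "R x y" if ij: "i < Suc (Suc r)" "j < Suc (Suc r)" "i \<noteq> j" "x \<in> P i" "y \<in> P j" for i j x y
    proof -
      consider "i = Suc r" "j < Suc r" | "j = Suc r" "i < Suc r" | "i < Suc r" "j < Suc r"
        using ij by linarith
      then show ?thesis
      proof cases
        case 1
        then have "x \<in> Y'" "y \<in> W j" using that by (auto simp: P_def)
        then have "R y x" using W[of j] 1 by blast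
        then show ?thesis using S(3) by (auto dest: sympD)
      next
        case 2
        then have "y \<in> Y'" "x \<in> W i" using that by (auto simp: P_def)
        then show ?thesis using W[of i] 2 by blast
      next
        case 3
        then have "x \<in> W i" "y \<in> W j" using that by (auto simp: P_def)
        then have "x \<in> V i" "y \<in> V j" using W[of i] W[of j] 3 by auto
        then show ?thesis using V 3 that(3) unfolding complete_parts_def by blast
      qed
    qed
    have "P i \<subseteq> S \<and> card (P i) = t" if "i < Suc (Suc r)" for i
    proof (cases "i = Suc r")
      case False
      then have i: "i < Suc r" using that by simp
      show ?thesis using W[OF i] VS(1)[OF i] False by (auto simp: P_def)
    qed (use Y' in \<open>simp add: P_def\<close>)
    then have "complete_parts R S (Suc (Suc r)) t P"
      using R by (auto simp: complete_parts_def)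
    then show "\<exists>P. complete_parts R S (Suc (Suc r)) t P" by blast
  qed
qed


text \<open>The excess is measured against \<open>n\<close> rather than \<open>card A\<close>. As
  there are at most \<open>card A ^ 2\<close> pairs, the hypothesis forces \<open>A\<close> itself
  to be of linear size, so one threshold on \<open>n\<close> covers all \<open>A\<close>. A suitable
  subset of \<open>A\<close> turns the average degree into a minimum degree.\<close>

lemma Erdos_Stone_density:
  fixes \<eta> :: real
  assumes "\<eta> > 0" "1 \<le> t" "1 \<le> r"
  shows "\<forall>\<^sub>F n in sequentially. \<forall>A. \<forall>R :: 'a \<Rightarrow> 'a \<Rightarrow> bool. finite A \<and> card A \<le> n \<and> symp R \<and>
    (real r - 1) * real (card A) ^ 2 + \<eta> * real n ^ 2 \<le> real r * pair_count R A A \<longrightarrow>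
    (\<exists>P. complete_parts R A (Suc r) t P)"
proof -
  \<comment> \<open>Half of the excess \<open>\<eta>\<close> keeps \<open>f A\<close> quadratic in
    \<open>n\<close>; the other half enters \<open>c\<close>, so that the minimum degree gains a
    positive slack.\<close>
  define c where "c = real r - 1 + \<eta>/2"
  have c: "c > 0" "c \<ge> \<eta>/2" using assms by (auto simp: c_def)
  obtain n0 where n0: "\<And>S. \<And>R :: 'a \<Rightarrow> 'a \<Rightarrow> bool. finite S \<Longrightarrow> n0 \<le> card S \<Longrightarrow> symp R \<Longrightarrow>
    \<forall>v\<in>S. (real r - 1 + \<eta>/4) * card S \<le> real r * card {w\<in>S. R v w} \<Longrightarrow>
    \<exists>P. complete_parts R S (Suc r) t P"
  proof -
    obtain n0 where "\<forall>S. \<forall>R :: 'a \<Rightarrow> 'a \<Rightarrow> bool. finite S \<and> n0 \<le> card S \<and> symp R \<and>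
      (\<forall>v\<in>S. (real r - 1 + \<eta>/4) * card S \<le> real r * card {w\<in>S. R v w}) \<longrightarrow>
      (\<exists>P. complete_parts R S (Suc r) t P)"
      using Erdos_Stone_min_degree[of "\<eta>/4" t r] assms by auto
    then show ?thesis by (intro that[of n0]) blast
  qed
  \<comment> \<open>The first bound makes the maximiser large enough for the minimum degree version;
    the second absorbs the term \<open>c / 2\<close> that deleting one vertex leaves behind.\<close>
  define s0 where "s0 = max (real n0) (2 * c / \<eta>)"
  have s0: "s0 \<ge> 0" by (simp add: s0_def)
  have "\<forall>\<^sub>F n in sequentially. s0 \<le> sqrt (\<eta> / (2 * real r)) * real n"
    using assms by (intro eventually_nat_ge_real) auto
  then show ?thesis
  proof eventually_elim
    case (elim n)
    show ?case
    proof (intro allI impI, elim conjE)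
      fix A :: "'a set" and R
      assume A: "finite A" "card A \<le> n" "symp R"
        and dens: "(real r - 1) * real (card A) ^ 2 + \<eta> * real n ^ 2 \<le> real r * pair_count R A A"
      \<comment> \<open>Deleting a vertex of small degree would increase \<open>f\<close>, so a maximiser of \<open>f\<close> has large
        minimum degree; it is a large set because \<open>f A\<close> is quadratic in \<open>n\<close>.\<close>
      define f where "f S = real r * pair_count R S S - c * real (card S) ^ 2" for S
      have "finite (f ` Pow A)" "f ` Pow A \<noteq> {}" using A by auto
      then obtain S where S: "S \<subseteq> A" and maxS: "f S = Max (f ` Pow A)"
        using Max_in by (metis (no_types, lifting) PowD imageE)
      have max: "f S' \<le> f S" if "S' \<subseteq> A" for S'
        using that A by (simp add: maxS)
      have finS: "finite S" using S A finite_subset by blast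
      define s where "s = real (card S)"
      have "\<eta>/2 * real (card A) ^ 2 \<le> \<eta>/2 * real n ^ 2"
        using A assms by (intro mult_left_mono power_mono) auto
      then have "\<eta>/2 * real n ^ 2 \<le> f A"
        using dens by (simp add: f_def c_def algebra_simps)
      also have "\<dots> \<le> f S" by (rule max) simp
      also have "\<dots> \<le> real r * s ^ 2"
      proof -
        have "real (pair_count R S S) \<le> real (card S * card S)"
          using pair_count_le[OF finS] of_nat_mono by blast
        then have "real r * pair_count R S S \<le> real r * (s * s)"
          by (intro mult_left_mono) (auto simp: s_def)
        moreover have "0 \<le> c * s ^ 2" using c by simp
        ultimately show ?thesis by (simp add: f_def s_def power2_eq_square)
      qed
      finally have "\<eta> / (2 * real r) * real n ^ 2 \<le> s ^ 2"
        using assms by (simp add: field_simps)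
      then have "(sqrt (\<eta> / (2 * real r)) * real n) ^ 2 \<le> s ^ 2"
        using assms by (simp add: power_mult_distrib)
      then have "sqrt (\<eta> / (2 * real r)) * real n \<le> s"
        by (rule power2_le_imp_le) (simp add: s_def)
      then have "s0 \<le> s" using elim by simp
      then have s: "n0 \<le> card S" "2 * c / \<eta> \<le> s" by (auto simp: s0_def s_def)
      then have s2: "c / 2 \<le> \<eta>/4 * s" using assms by (simp add: field_simps)
      have "(real r - 1 + \<eta>/4) * card S \<le> real r * card {w\<in>S. R v w}" if v: "v \<in> S" for v
      proof -
        define d where "d = card {w\<in>S. R v w}"
        define S' where "S' = S - {v}"
        have eq: "S = S' \<union> {v}" "S' \<inter> {v} = {}" "finite S'"
          using v finS by (auto simp: S'_def)
        have single: "pair_count R {v} Y \<le> d" if "Y \<subseteq> S" for Y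
          unfolding pair_count_def d_def using that finS by (auto intro!: card_mono)
        \<comment> \<open>Deleting \<open>v\<close> removes its row and its column, hence at most
          \<open>2 * d\<close> ordered pairs.\<close>
        have "pair_count R S S = pair_count R S' S + pair_count R {v} S"
          using pair_count_union_left[OF eq(3) _ eq(2), of R S] eq(1) by simp
        also have "pair_count R S' S = pair_count R S' S' + pair_count R S' {v}"
          using pair_count_union_right[OF eq(3) _ eq(2), of R S'] eq(1) by simp
        also have "pair_count R S' {v} = pair_count R {v} S'"
          using eq A by (intro pair_count_sym) auto
        finally have "pair_count R S S \<le> pair_count R S' S' + 2 * d"
          using single[of S] single[of S'] by (auto simp: S'_def)
        then have "real (pair_count R S S) \<le> real (pair_count R S' S' + 2 * d)"
          by (simp only: of_nat_le_iff)
        then have "real r * real (pair_count R S S) \<le> real r * (real (pair_count R S' S') + 2 * real d)"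
          by (intro mult_left_mono) auto
        moreover have "f S' \<le> f S" using S by (intro max) (auto simp: S'_def)
        moreover have "real (card S') = s - 1"
          using v finS card_gt_0_iff[of S] by (auto simp: S'_def s_def of_nat_diff Suc_le_eq)
        \<comment> \<open>Maximality of \<open>f S\<close> compares the loss in the quadratic term
          with the loss in pairs. The left side is \<open>c * (2 * s - 1)\<close>.\<close>
        ultimately have "c * s^2 - c * (s - 1)^2 \<le> 2 * real r * d"
          by (simp add: f_def s_def algebra_simps)
        then have "c * s - c / 2 \<le> real r * d"
          by (simp add: power2_eq_square algebra_simps)
        moreover have "(real r - 1 + \<eta>/4) * s = c * s - \<eta>/4 * s"
          by (simp add: c_def algebra_simps)
        ultimately show ?thesis using s2 by (simp add: s_def d_def)
      qed
      then obtain P where "complete_parts R S (Suc r) t P"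
        using n0[of S R] finS s A by blast
      then show "\<exists>P. complete_parts R A (Suc r) t P"
        using S by (intro exI[of _ P]) (auto simp: complete_parts_def)
    qed
  qed
qed


section \<open>Densities of hypergraphs with edges of size one and two\<close>

text \<open>The condition \<open>x \<noteq> y\<close> is there because \<open>{x, x}\<close> is the
  1-edge at \<open>x\<close>.\<close>

definition adj :: "'a set set \<Rightarrow> 'a \<Rightarrow> 'a \<Rightarrow> bool" where
  "adj G x y \<longleftrightarrow> x \<noteq> y \<and> {x, y} \<in> G"

definition singles :: "'a set set \<Rightarrow> 'a set" where
  "singles G = {x. {x} \<in> G}"

lemma symp_adj: "symp (adj G)"
  by (auto simp: symp_def adj_def insert_commute)

lemma singles_subset: "G \<subseteq> Pow U \<Longrightarrow> singles G \<subseteq> U"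
  by (auto simp: singles_def)

text \<open>Count incidences between vertices and 2-edges: the neighbours of \<open>x\<close>
  correspond to the 2-edges through \<open>x\<close>, and every 2-edge has two ends. The factor 2
  later cancels against the one in \<open>n choose 2\<close>.\<close>

lemma pair_count_adj:
  assumes "finite U" "G \<subseteq> Pow U"
  shows "pair_count (adj G) U U = 2 * card {F\<in>G. card F = 2}"
proof -
  let ?G2 = "{F\<in>G. card F = 2}"
  have fin: "finite ?G2" using assms finite_subset[of G "Pow U"] by auto
  have "card {y\<in>U. adj G x y} = card {F\<in>?G2. x \<in> F}" if "x \<in> U" for x
  proof -
    have "bij_betw (\<lambda>y. {x, y}) {y\<in>U. adj G x y} {F\<in>?G2. x \<in> F}"
      unfolding bij_betw_def
    proof
      show "inj_on (\<lambda>y. {x, y}) {y \<in> U. adj G x y}"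
        by (auto simp: inj_on_def doubleton_eq_iff)
      show "(\<lambda>y. {x, y}) ` {y \<in> U. adj G x y} = {F\<in>?G2. x \<in> F}"
      proof (intro equalityI subsetI)
        fix F assume F: "F \<in> {F\<in>?G2. x \<in> F}"
        then obtain a b where ab: "F = {a, b}" "a \<noteq> b" by (auto simp: card_2_iff)
        then obtain y where "F = {x, y}" "x \<noteq> y" using F by auto
        then show "F \<in> (\<lambda>y. {x, y}) ` {y \<in> U. adj G x y}"
          using F assms(2) by (intro image_eqI[of _ _ y]) (auto simp: adj_def)
      qed (auto simp: adj_def)
    qed
    then show ?thesis by (rule bij_betw_same_card)
  qed
  then have "pair_count (adj G) U U = pair_count (\<lambda>x F. x \<in> F) U ?G2"
    by (simp add: pair_count_def)
  also have "\<dots> = (\<Sum>F\<in>?G2. card {x\<in>U. x \<in> F})"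
    using assms fin by (intro pair_count_swap) auto
  also have "\<dots> = (\<Sum>F\<in>?G2. 2)"
  proof (rule sum.cong[OF refl])
    fix F assume F: "F \<in> ?G2"
    then have "{x\<in>U. x \<in> F} = F" using assms by auto
    then show "card {x\<in>U. x \<in> F} = 2" using F by simp
  qed
  finally show ?thesis by simp
qed

lemma hdens_eq:
  assumes G: "G \<subseteq> Pow {0..<n}" and sizes: "edge_sizes G \<subseteq> {1, 2}"
  shows "hdens n G = real (card (singles G)) / n +
    real (pair_count (adj G) {0..<n} {0..<n}) / (real n * (real n - 1))"
proof -
  let ?G1 = "{F\<in>G. card F = 1}" and ?G2 = "{F\<in>G. card F = 2}"
  have fin: "finite G" using G finite_subset by blast
  have un: "G = ?G1 \<union> ?G2" using sizes by (auto simp: edge_sizes_def)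
  have "hdens n G = (\<Sum>F\<in>?G1. 1 / real (n choose card F)) + (\<Sum>F\<in>?G2. 1 / real (n choose card F))"
    unfolding hdens_def by (subst un, rule sum.union_disjoint) (use fin in auto)
  also have "(\<Sum>F\<in>?G1. 1 / real (n choose card F)) = (\<Sum>F\<in>?G1. 1 / real n)"
    by (rule sum.cong) auto
  also have "\<dots> = card (singles G) / real n"
  proof -
    have "?G1 = (\<lambda>x. {x}) ` singles G"
      by (auto simp: singles_def card_1_singleton_iff)
    then show ?thesis by (simp add: card_image)
  qed
  also have "(\<Sum>F\<in>?G2. 1 / real (n choose card F)) = (\<Sum>F\<in>?G2. 2 / (real n * (real n - 1)))"
  proof (rule sum.cong[OF refl])
    fix F assume F: "F \<in> ?G2"
    have *: "real (n choose 2) = real n * (real n - 1) / 2"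
    proof -
      have "even (n * (n - 1))" by (cases n) auto
      then have "real (n choose 2) = real (n * (n - 1)) / 2"
        unfolding choose_two by (simp add: real_of_nat_div)
      then show ?thesis by (cases n) (auto simp: algebra_simps)
    qed
    have "card F = 2" using F by simp
    then show "1 / real (n choose card F) = 2 / (real n * (real n - 1))"
      by (simp only: *) simp
  qed
  also have "\<dots> = real (pair_count (adj G) {0..<n} {0..<n}) / (real n * (real n - 1))"
    using pair_count_adj[OF _ G] by simp
  finally show ?thesis .
qed

text \<open>Replacing \<open>n * (n - 1)\<close> by \<open>n ^ 2\<close> changes the 2-edge density
  by exactly its \<open>1 / n\<close>-th part, and this density is at most 1.\<close>

lemma hdens_le:
  assumes G: "G \<subseteq> Pow {0..<n}" "edge_sizes G \<subseteq> {1, 2}" and n: "2 \<le> n"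
  shows "hdens n G \<le> real (card (singles G)) / n +
    real (pair_count (adj G) {0..<n} {0..<n}) / real n ^ 2 + 1 / n"
proof -
  define e where "e = real (pair_count (adj G) {0..<n} {0..<n})"
  have "pair_count (adj G) {0..<n} {0..<n} \<le> (\<Sum>x\<in>{0..<n}. n - 1)"
    unfolding pair_count_def
  proof (rule sum_mono)
    fix x assume "x \<in> {0..<n}"
    then have "card {y \<in> {0..<n}. adj G x y} \<le> card ({0..<n} - {x})"
      by (intro card_mono) (auto simp: adj_def)
    then show "card {y \<in> {0..<n}. adj G x y} \<le> n - 1"
      using \<open>x \<in> {0..<n}\<close> by simp
  qed
  then have "e \<le> real (n * (n - 1))"
    unfolding e_def by (simp only: of_nat_le_iff) simp
  then have e: "e \<le> real n * (real n - 1)" using n by (simp add: of_nat_diff)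
  have "e / (real n * (real n - 1)) = e / real n ^ 2 + e / (real n * (real n - 1)) * (1 / n)"
    using n by (simp add: field_simps power2_eq_square)
  also have "e / (real n * (real n - 1)) * (1 / n) \<le> 1 * (1 / n)"
    using e n by (intro mult_right_mono) auto
  finally show ?thesis using hdens_eq[OF G] by (simp add: e_def)
qed

lemma hdens_ge:
  assumes G: "G \<subseteq> Pow {0..<n}" "edge_sizes G \<subseteq> {1, 2}" and n: "2 \<le> n"
  shows "real (card (singles G)) / n +
    real (pair_count (adj G) {0..<n} {0..<n}) / real n ^ 2 \<le> hdens n G"
proof -
  have "real (pair_count (adj G) {0..<n} {0..<n}) / real n ^ 2 \<le>
    real (pair_count (adj G) {0..<n} {0..<n}) / (real n * (real n - 1))"
    using n by (intro divide_left_mono) (auto simp: power2_eq_square)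
  then show ?thesis using hdens_eq[OF G] by simp
qed

section \<open>Embedding into blow-ups\<close>

lemma greedy_injection:
  assumes "finite V" "\<And>v. v \<in> V \<Longrightarrow> card V \<le> card (P v)"
  shows "\<exists>f. inj_on f V \<and> (\<forall>v\<in>V. f v \<in> P v)"
  using assms
proof (induction V)
  case (insert x V)
  have "card V \<le> card (P v)" if "v \<in> V" for v
    using insert.prems[of v] insert.hyps that by auto
  then obtain f where f: "inj_on f V" "\<forall>v\<in>V. f v \<in> P v" using insert.IH by blast
  have "card (f ` V) < card (P x)"
    using insert.prems[of x] insert.hyps card_image_le[of V f] by auto
  then have "\<not> P x \<subseteq> f ` V"
    using insert.hyps card_mono[of "f ` V" "P x"] by auto
  then obtain y where y: "y \<in> P x" "y \<notin> f ` V" by blast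
  have "inj_on (f(x := y)) (insert x V)"
    using f y insert.hyps by (auto simp: inj_on_def)
  moreover have "\<forall>v\<in>insert x V. (f(x := y)) v \<in> P v" using f y by auto
  ultimately show ?case by blast
qed simp

text \<open>The sets \<open>P v\<close> need not be disjoint for different vertices: as each has at least as many
  elements as there are vertices, an injective choice can be made greedily.\<close>

lemma subhypergraph_blowup:
  assumes H: "hypergraph V E" "edge_sizes E \<subseteq> {1, 2}"
    and P: "\<And>v. v \<in> V \<Longrightarrow> P v \<subseteq> U \<and> card V \<le> card (P v)"
    and P1: "\<And>v. {v} \<in> E \<Longrightarrow> P v \<subseteq> singles G"
    and P2: "\<And>u v x y. u \<noteq> v \<Longrightarrow> {u, v} \<in> E \<Longrightarrow> x \<in> P u \<Longrightarrow> y \<in> P v \<Longrightarrow> adj G x y"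
  shows "subhypergraph V E U G"
proof -
  obtain f where f: "inj_on f V" "\<And>v. v \<in> V \<Longrightarrow> f v \<in> P v"
    using greedy_injection[of V P] P H(1) by (auto simp: hypergraph_def)
  have "f ` F \<in> G" if F: "F \<in> E" for F
  proof -
    have FV: "F \<subseteq> V" using F H by (auto simp: hypergraph_def)
    have "card F = 1 \<or> card F = 2" using F H by (auto simp: edge_sizes_def)
    then show ?thesis
    proof
      assume "card F = 1"
      then obtain v where "F = {v}" by (auto simp: card_1_singleton_iff)
      then show ?thesis using P1[of v] f(2)[of v] F FV by (auto simp: singles_def)
    next
      assume "card F = 2"
      then obtain u v where "F = {u, v}" "u \<noteq> v" by (auto simp: card_2_iff)
      then show ?thesis using P2[of u v "f u" "f v"] f(2)[of v] f(2)[of u] F FV by (auto simp: adj_def)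
    qed
  qed
  moreover have "f ` V \<subseteq> U" using f(2) P by blast
  ultimately show ?thesis using f(1) by (auto simp: subhypergraph_def)
qed

section \<open>Reduction of the limit to two estimates\<close>

definition avoiding :: "'a set \<Rightarrow> 'a set set \<Rightarrow> nat \<Rightarrow> nat set set \<Rightarrow> bool" where
  "avoiding V E n G \<longleftrightarrow> G \<subseteq> Pow {0..<n} \<and> edge_sizes G \<subseteq> {1, 2} \<and> \<not> subhypergraph V E {0..<n} G"

text \<open>Upper estimates are convenient in the normalisation by \<open>n ^ 2\<close>, whose error
  \<open>1 / n\<close> is absorbed here. Lower estimates come from explicit hypergraphs.\<close>

lemma pi_n_tendsto:
  assumes sizes: "edge_sizes E = {1, 2}"
    and upper: "\<And>\<eta>::real. 0 < \<eta> \<Longrightarrow> \<forall>\<^sub>F n in sequentially. \<forall>G. avoiding V E n G \<longrightarrow>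
      real (card (singles G)) / n + real (pair_count (adj G) {0..<n} {0..<n}) / real n ^ 2 \<le> L + \<eta>"
    and lower: "\<And>\<eta>::real. 0 < \<eta> \<Longrightarrow> \<forall>\<^sub>F n in sequentially. \<exists>G. avoiding V E n G \<and> L - \<eta> \<le> hdens n G"
  shows "(\<lambda>n. pi_n n V E) \<longlonglongrightarrow> L"
proof (rule tendstoI)
  fix e :: real assume e: "0 < e"
  have "\<forall>\<^sub>F n in sequentially. 4 \<le> e * real n" "\<forall>\<^sub>F n in sequentially. 2 \<le> 1 * real n"
    using e by (intro eventually_nat_ge_real; simp)+
  moreover have "\<forall>\<^sub>F n in sequentially. \<forall>G. avoiding V E n G \<longrightarrow>
      real (card (singles G)) / n + real (pair_count (adj G) {0..<n} {0..<n}) / real n ^ 2 \<le> L + e/4"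
    "\<forall>\<^sub>F n in sequentially. \<exists>G. avoiding V E n G \<and> L - e/2 \<le> hdens n G"
    using upper[of "e/4"] lower[of "e/2"] e by auto
  ultimately show "\<forall>\<^sub>F n in sequentially. dist (pi_n n V E) L < e"
  proof eventually_elim
    case (elim n)
    have pi: "pi_n n V E = Max (hdens n ` {G. avoiding V E n G})"
      unfolding pi_n_def avoiding_def sizes by (rule arg_cong[of _ _ Max]) auto
    have "{G. avoiding V E n G} \<subseteq> Pow (Pow {0..<n})" by (auto simp: avoiding_def)
    then have fin: "finite (hdens n ` {G. avoiding V E n G})"
      by (meson finite_Pow_iff finite_atLeastLessThan finite_imageI finite_subset)
    \<comment> \<open>The witness also shows that the maximum ranges over a nonempty set, as the
      upper bound on \<open>Max\<close> requires.\<close>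
    obtain G0 where G0: "avoiding V E n G0" "L - e/2 \<le> hdens n G0" using elim by blast
    then have "L - e/2 \<le> pi_n n V E"
      unfolding pi using fin by (intro order_trans[OF G0(2)] Max_ge) auto
    moreover have "pi_n n V E \<le> L + e/2"
      unfolding pi
    proof (rule Max.boundedI[OF fin])
      fix x assume "x \<in> hdens n ` {G. avoiding V E n G}"
      then obtain G where G: "avoiding V E n G" "x = hdens n G" by auto
      have "1 / real n \<le> e/4" using elim by (simp add: field_simps)
      moreover have "hdens n G \<le> real (card (singles G)) / n +
          real (pair_count (adj G) {0..<n} {0..<n}) / real n ^ 2 + 1 / n"
        using G(1) elim(2) by (intro hdens_le) (auto simp: avoiding_def)
      moreover have "real (card (singles G)) / n +
          real (pair_count (adj G) {0..<n} {0..<n}) / real n ^ 2 \<le> L + e/4"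
        by (rule elim(3)[rule_format, OF G(1)])
      ultimately show "x \<le> L + e/2" using G(2) by linarith
    qed (use G0 in auto)
    ultimately show ?case unfolding dist_real_def using e by linarith
  qed
qed


section \<open>Upper bounds\<close>

lemma pair_count_split:
  assumes "finite X" "finite Y" "X \<inter> Y = {}" "symp R"
  shows "pair_count R (X \<union> Y) (X \<union> Y) = pair_count R X X + 2 * pair_count R Y X + pair_count R Y Y"
  using assms pair_count_sym[of X Y R]
  by (simp add: pair_count_union_left pair_count_union_right)

lemma real_pair_count_le: "finite Y \<Longrightarrow> real (pair_count R X Y) \<le> real (card X) * real (card Y)"
  using pair_count_le[of Y R X] by (metis of_nat_le_iff of_nat_mult)

definition proper_colouring :: "'a set set \<Rightarrow> ('a \<Rightarrow> 'b) \<Rightarrow> bool" where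
  "proper_colouring E c \<longleftrightarrow> (\<forall>u v. adj E u v \<longrightarrow> c u \<noteq> c v)"

text \<open>Each vertex is placed in the part of its colour. The 1-edges are no obstacle, since all
  parts lie among the 1-edges of \<open>G\<close>.\<close>

lemma complete_parts_subhypergraph:
  assumes H: "hypergraph V E" "edge_sizes E \<subseteq> {1, 2}"
    and c: "proper_colouring E c" "\<And>v. v \<in> V \<Longrightarrow> c v < r"
    and P: "complete_parts (adj G) A r (card V) P" and A: "A \<subseteq> singles G" "A \<subseteq> U"
  shows "subhypergraph V E U G"
proof (rule subhypergraph_blowup[OF H, where P = "\<lambda>v. P (c v)"])
  have inV: "v \<in> V" if "v \<in> F" "F \<in> E" for v F
    using H(1) that by (auto simp: hypergraph_def)
  have PA: "P (c v) \<subseteq> A" "card (P (c v)) = card V" if "v \<in> V" for v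
    using P c(2)[OF that] by (auto simp: complete_parts_def)
  show "P (c v) \<subseteq> U \<and> card V \<le> card (P (c v))" if "v \<in> V" for v
    using PA[OF that] A by auto
  show "P (c v) \<subseteq> singles G" if "{v} \<in> E" for v
    using PA(1)[of v] A inV[OF _ that] by auto
  show "adj G x y" if "u \<noteq> v" "{u, v} \<in> E" "x \<in> P (c u)" "y \<in> P (c v)" for u v x y
  proof -
    have "c u \<noteq> c v" using c(1) that by (auto simp: proper_colouring_def adj_def)
    moreover have "c u < r" "c v < r" using c(2) inV[OF _ that(2)] by auto
    ultimately show ?thesis using P that(3,4) unfolding complete_parts_def by blast
  qed
qed

text \<open>Erdos-Stone is applied only inside the set \<open>A\<close> of 1-edges; all other pairs
  are counted as if present. The bound \<open>L\<close> is kept abstract because the optimal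
  relative size of \<open>A\<close> depends on \<open>r\<close>.\<close>

lemma upper_bound_colourable:
  fixes L :: real
  assumes H: "hypergraph V E" "edge_sizes E \<subseteq> {1, 2}" "V \<noteq> {}"
    and c: "proper_colouring E c" "\<And>v. v \<in> V \<Longrightarrow> c v < Suc r" and r: "1 \<le> r"
    and L: "\<And>a::real. 0 \<le> a \<Longrightarrow> a \<le> 1 \<Longrightarrow> a + 1 - a ^ 2 / real r \<le> L"
    and \<eta>: "0 < \<eta>"
  shows "\<forall>\<^sub>F n in sequentially. \<forall>G. avoiding V E n G \<longrightarrow>
      real (card (singles G)) / n + real (pair_count (adj G) {0..<n} {0..<n}) / real n ^ 2 \<le> L + \<eta>"
proof -
  have t: "1 \<le> card V" using H by (auto simp: hypergraph_def Suc_le_eq card_gt_0_iff)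
  have "\<forall>\<^sub>F n in sequentially. \<forall>A. \<forall>R :: nat \<Rightarrow> nat \<Rightarrow> bool. finite A \<and> card A \<le> n \<and> symp R \<and>
    (real r - 1) * real (card A) ^ 2 + \<eta> * real n ^ 2 \<le> real r * pair_count R A A \<longrightarrow>
    (\<exists>P. complete_parts R A (Suc r) (card V) P)"
    by (rule Erdos_Stone_density[OF \<eta> t r])
  moreover have "\<forall>\<^sub>F n in sequentially. (1::nat) \<le> n" by (rule eventually_ge_at_top)
  ultimately show ?thesis
  proof eventually_elim
    case (elim n)
    show ?case
    proof (intro allI impI)
      fix G assume G: "avoiding V E n G"
      define A where "A = singles G"
      define B where "B = {0..<n} - A"
      have An: "A \<subseteq> {0..<n}" using G singles_subset by (auto simp: A_def avoiding_def)
      have fin: "finite A" "finite B" using An finite_subset by (auto simp: B_def)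
      have U: "{0..<n} = A \<union> B" "A \<inter> B = {}" using An by (auto simp: B_def)
      have cA: "card A \<le> n" using card_mono[OF _ An] by simp
      have cB: "real (card B) = real n - real (card A)"
        using card_Diff_subset[OF fin(1) An] cA by (simp add: B_def of_nat_diff)
      define a where "a = real (card A) / n"
      have n: "real n > 0" using elim by simp
      have a: "0 \<le> a" "a \<le> 1" "real (card A) = a * n" using cA n by (auto simp: a_def)
      let ?e = "\<lambda>X Y. real (pair_count (adj G) X Y)"
      have "\<not> (real r - 1) * real (card A) ^ 2 + \<eta> * real n ^ 2 \<le> real r * ?e A A"
      proof
        assume "(real r - 1) * real (card A) ^ 2 + \<eta> * real n ^ 2 \<le> real r * ?e A A"
        then obtain P where "complete_parts (adj G) A (Suc r) (card V) P"
          using elim(1)[rule_format, of A "adj G"] fin cA symp_adj by blast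
        then have "subhypergraph V E {0..<n} G"
          using An by (intro complete_parts_subhypergraph[OF H(1,2) c, where A = A and P = P]) (auto simp: A_def)
        then show False using G by (simp add: avoiding_def)
      qed
      then have eA: "real r * ?e A A \<le> (real r - 1) * real (card A) ^ 2 + \<eta> * real n ^ 2" by simp
      have "?e {0..<n} {0..<n} = ?e A A + 2 * ?e B A + ?e B B"
        using pair_count_split[OF fin U(2) symp_adj[of G]] U(1) by simp
      also have "\<dots> \<le> ?e A A + 2 * (card B * card A) + card B * card B"
        using real_pair_count_le[OF fin(1), of "adj G" B] real_pair_count_le[OF fin(2), of "adj G" B] by simp
      \<comment> \<open>The pairs not inside \<open>A\<close> number
        \<open>n ^ 2 - card A ^ 2\<close>.\<close>
      also have "\<dots> = ?e A A + real n ^ 2 - real (card A) ^ 2"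
        by (simp add: cB power2_eq_square algebra_simps)
      finally have "real r * ?e {0..<n} {0..<n} \<le> real r * (?e A A + real n ^ 2 - real (card A) ^ 2)"
        by (intro mult_left_mono) auto
      also have "\<dots> \<le> (real r - a ^ 2 + \<eta>) * real n ^ 2"
        using eA by (simp add: a(3) power_mult_distrib algebra_simps)
      finally have "?e {0..<n} {0..<n} / real n ^ 2 \<le> (real r - a ^ 2 + \<eta>) / real r"
        using n r by (simp add: field_simps)
      also have "\<dots> = 1 - a ^ 2 / real r + \<eta> / real r" using r by (simp add: field_simps)
      also have "\<eta> / real r \<le> \<eta>" using \<eta> r by (simp add: field_simps)
      finally show "real (card (singles G)) / n + ?e {0..<n} {0..<n} / real n ^ 2 \<le> L + \<eta>"
        using L[OF a(1,2)] by (simp add: a_def A_def)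
    qed
  qed
qed

text \<open>With all 1-edges of \<open>H\<close> in one colour class, a complete bipartite graph
  with just one side in \<open>A\<close> contains \<open>H\<close>. Hence almost no 2-edge meets
  \<open>A\<close>, and the density is at most about \<open>a + (1 - a) ^ 2\<close>, which does not
  exceed 1.\<close>

lemma upper_bound_aligned:
  assumes H: "hypergraph V E" "edge_sizes E \<subseteq> {1, 2}" "V \<noteq> {}"
    and c: "proper_colouring E c" "\<And>v. v \<in> singles E \<Longrightarrow> c v"
    and \<eta>: "0 < \<eta>"
  shows "\<forall>\<^sub>F n in sequentially. \<forall>G. avoiding V E n G \<longrightarrow>
      real (card (singles G)) / n + real (pair_count (adj G) {0..<n} {0..<n}) / real n ^ 2 \<le> 1 + \<eta>"
proof -
  have t: "1 \<le> card V" using H by (auto simp: hypergraph_def Suc_le_eq card_gt_0_iff)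
  have "\<forall>\<^sub>F n in sequentially. \<forall>X Y. \<forall>R :: nat \<Rightarrow> nat \<Rightarrow> bool.
    finite X \<and> finite Y \<and> card X \<le> n \<and> card Y \<le> n \<and> \<eta>/2 * real n ^ 2 \<le> pair_count R X Y \<longrightarrow>
    (\<exists>X' Y'. X' \<subseteq> X \<and> card X' = card V \<and> Y' \<subseteq> Y \<and> card Y' = card V \<and> (\<forall>x\<in>X'. \<forall>y\<in>Y'. R x y))"
    using \<eta> t by (intro dense_pair_complete_bipartite) auto
  moreover have "\<forall>\<^sub>F n in sequentially. (1::nat) \<le> n" by (rule eventually_ge_at_top)
  ultimately show ?thesis
  proof eventually_elim
    case (elim n)
    show ?case
    proof (intro allI impI)
      fix G assume G: "avoiding V E n G"
      define A where "A = singles G"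
      define B where "B = {0..<n} - A"
      have An: "A \<subseteq> {0..<n}" using G singles_subset by (auto simp: A_def avoiding_def)
      have fin: "finite A" "finite B" using An finite_subset by (auto simp: B_def)
      have U: "{0..<n} = A \<union> B" "A \<inter> B = {}" using An by (auto simp: B_def)
      have cA: "card A \<le> n" using card_mono[OF _ An] by simp
      have cB: "real (card B) = real n - real (card A)"
        using card_Diff_subset[OF fin(1) An] cA by (simp add: B_def of_nat_diff)
      define a where "a = real (card A) / n"
      have n: "real n > 0" using elim by simp
      have a: "0 \<le> a" "a \<le> 1" "real (card A) = a * n" using cA n by (auto simp: a_def)
      let ?e = "\<lambda>X Y. real (pair_count (adj G) X Y)"
      have "\<not> \<eta>/2 * real n ^ 2 \<le> ?e {0..<n} A"
      proof
        assume "\<eta>/2 * real n ^ 2 \<le> ?e {0..<n} A"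
        then obtain X Y where XY: "X \<subseteq> {0..<n}" "card X = card V" "Y \<subseteq> A" "card Y = card V"
          "\<forall>x\<in>X. \<forall>y\<in>Y. adj G x y"
          using elim(1)[rule_format, of "{0..<n}" A "adj G"] fin cA by auto
        have "subhypergraph V E {0..<n} G"
        proof (rule subhypergraph_blowup[OF H(1,2), where P = "\<lambda>v. if c v then Y else X"])
          show "adj G x y" if "u \<noteq> v" "{u, v} \<in> E" "x \<in> (if c u then Y else X)"
            "y \<in> (if c v then Y else X)" for u v x y
          proof -
            have "c u \<noteq> c v" using c(1) that by (auto simp: proper_colouring_def adj_def)
            then show ?thesis using that(3,4) XY(5) sympD[OF symp_adj, of G]
              by (auto split: if_splits)
          qed
          show "(if c v then Y else X) \<subseteq> singles G" if "{v} \<in> E" for v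
            using c(2)[of v] that XY by (simp add: singles_def A_def)
        qed (use XY An in auto)
        then show False using G by (simp add: avoiding_def)
      qed
      then have eA: "?e A A + ?e B A \<le> \<eta>/2 * real n ^ 2"
        using pair_count_union_left[OF fin U(2), of "adj G" A] U(1) by simp
      have "?e {0..<n} {0..<n} = ?e A A + 2 * ?e B A + ?e B B"
        using pair_count_split[OF fin U(2) symp_adj[of G]] U(1) by simp
      \<comment> \<open>Pairs between \<open>A\<close> and \<open>B\<close> occur in both orders, so
        twice the bound \<open>\<eta>/2\<close> is spent.\<close>
      also have "\<dots> \<le> \<eta> * real n ^ 2 + card B * card B"
        using real_pair_count_le[OF fin(2), of "adj G" B] eA of_nat_0_le_iff[of "pair_count (adj G) A A"]
        by (simp add: algebra_simps)
      also have "\<dots> = ((1 - a) ^ 2 + \<eta>) * real n ^ 2"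
        by (simp add: cB a(3) power2_eq_square algebra_simps)
      finally have "?e {0..<n} {0..<n} / real n ^ 2 \<le> (1 - a) ^ 2 + \<eta>"
        using n by (simp add: field_simps)
      moreover have "(1 - a) ^ 2 \<le> 1 - a"
        using a power_decreasing[of 1 2 "1 - a"] by simp
      ultimately show "real (card (singles G)) / n + ?e {0..<n} {0..<n} / real n ^ 2 \<le> 1 + \<eta>"
        by (simp add: a_def A_def)
    qed
  qed
qed

text \<open>Here \<open>a\<close>, \<open>b\<close>, \<open>m\<close> are the relative sizes of the
  1-edges \<open>A\<close>, of the vertices \<open>N\<close> with many neighbours in
  \<open>A\<close>, and of the rest \<open>M\<close>; only pairs inside \<open>A\<close>, inside
  \<open>N\<close> and between \<open>A\<close> and \<open>M\<close> are missing. Up to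
  \<open>a = 1/2\<close> the value is at most 1. Beyond that, \<open>b \<le> 1 - a\<close> gives
  \<open>a - b \<ge> 2 * a - 1\<close>, leaving a quadratic in \<open>a\<close> with maximum at
  \<open>a = 3/4\<close>.\<close>

lemma nine_eighths_bound:
  fixes a b m :: real
  assumes "0 \<le> a" "0 \<le> b" "0 \<le> m" "a + b + m = 1"
  shows "a + 2 * a * b + 2 * m * b + m ^ 2 \<le> 9 / 8"
proof -
  have m: "m = 1 - a - b" using assms by simp
  have eq: "a + 2 * a * b + 2 * m * b + m ^ 2 = 1 + (2 * a - 1) * a - (a - b) ^ 2"
    unfolding m by (simp add: power2_eq_square algebra_simps)
  show ?thesis
  proof (cases "2 * a \<le> 1")
    case True
    then have "(2 * a - 1) * a \<le> 0" using assms by (simp add: mult_nonpos_nonneg)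
    then show ?thesis unfolding eq using zero_le_power2[of "a - b"] by linarith
  next
    case False
    then have "(2 * a - 1) ^ 2 \<le> (a - b) ^ 2" using assms by (intro power_mono) auto
    moreover have "1 + (2 * a - 1) * a - (2 * a - 1) ^ 2 = 9 / 8 - 2 * (a - 3 / 4) ^ 2"
      by (simp add: power2_eq_square algebra_simps)
    ultimately show ?thesis unfolding eq using zero_le_power2[of "a - 3 / 4"] by linarith
  qed
qed

text \<open>Pairs inside \<open>A\<close> are few because a large complete bipartite graph there
  contains \<open>H\<close>. Pairs inside \<open>N\<close> are few because both sides of such a
  graph in \<open>N\<close> would have many common neighbours in \<open>A\<close>. Pairs between
  \<open>M\<close> and \<open>A\<close> are few by the choice of \<open>M\<close>.\<close>

lemma upper_bound_singles_independent:
  fixes c :: "'a \<Rightarrow> bool"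
  assumes H: "hypergraph V E" "edge_sizes E \<subseteq> {1, 2}" "V \<noteq> {}"
    and c: "proper_colouring E c"
    and ind: "\<And>u v. adj E u v \<Longrightarrow> u \<in> singles E \<Longrightarrow> v \<notin> singles E"
    and \<eta>: "0 < \<eta>"
  shows "\<forall>\<^sub>F n in sequentially. \<forall>G. avoiding V E n G \<longrightarrow>
      real (card (singles G)) / n + real (pair_count (adj G) {0..<n} {0..<n}) / real n ^ 2 \<le> 9 / 8 + \<eta>"
proof -
  have t: "1 \<le> card V" using H by (auto simp: hypergraph_def Suc_le_eq card_gt_0_iff)
  \<comment> \<open>There are four error terms: \<open>A\<close> with itself, \<open>N\<close> with
    itself, and \<open>M\<close> with \<open>A\<close> in both orders.\<close>
  define \<delta> where "\<delta> = \<eta> / 4"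
  have \<delta>: "0 < \<delta>" using \<eta> by (simp add: \<delta>_def)
  have "\<forall>\<^sub>F T in sequentially. 2 * real (card V) \<le> \<delta> * real T"
    by (rule eventually_nat_ge_real[OF \<delta>])
  moreover have "\<forall>\<^sub>F T in sequentially. (1::nat) \<le> T" by (rule eventually_ge_at_top)
  ultimately have "\<forall>\<^sub>F T in sequentially. 2 * real (card V) \<le> \<delta> * real T \<and> 1 \<le> T"
    by (rule eventually_conj)
  then obtain T :: nat where T: "2 * real (card V) \<le> \<delta> * real T" "1 \<le> T"
    using eventually_happens'[OF sequentially_bot] by blast
  \<comment> \<open>For \<open>r = 1\<close> the main term of Erdos-Stone vanishes. It is used with
    \<open>s = card V\<close> inside \<open>A\<close>, and inside \<open>N\<close> with
    \<open>s = T\<close>, since there the parts are thinned again to obtain common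
    neighbours.\<close>
  have ES: "\<forall>\<^sub>F n in sequentially. \<forall>A. \<forall>R :: nat \<Rightarrow> nat \<Rightarrow> bool. finite A \<and> card A \<le> n \<and> symp R \<and>
    \<delta> * real n ^ 2 \<le> pair_count R A A \<longrightarrow> (\<exists>P. complete_parts R A 2 s P)" if "1 \<le> s" for s
    using Erdos_Stone_density[OF \<delta> that, of 1] by (simp add: numeral_2_eq_2)
  have "\<forall>\<^sub>F n in sequentially. 2 * real (card V) * 2 ^ T \<le> \<delta> * real n"
    by (rule eventually_nat_ge_real[OF \<delta>])
  moreover have "\<forall>\<^sub>F n in sequentially. (1::nat) \<le> n" by (rule eventually_ge_at_top)
  ultimately show ?thesis
    using ES[OF t] ES[OF T(2)]
  proof eventually_elim
    case (elim n)
    show ?case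
    proof (intro allI impI)
      fix G assume G: "avoiding V E n G"
      define A where "A = singles G"
      define B where "B = {0..<n} - A"
      define N where "N = {x\<in>B. \<delta> * n \<le> card {y\<in>A. adj G x y}}"
      define M where "M = B - N"
      have An: "A \<subseteq> {0..<n}" using G singles_subset by (auto simp: A_def avoiding_def)
      have fin: "finite A" "finite B" "finite N" "finite M"
        using An finite_subset by (auto simp: B_def N_def M_def)
      have U: "{0..<n} = A \<union> B" "A \<inter> B = {}" "B = N \<union> M" "N \<inter> M = {}"
        using An by (auto simp: B_def M_def N_def)
      have cards: "card A + card N + card M = n"
        using card_Un_disjoint[OF fin(1,2) U(2)] card_Un_disjoint[OF fin(3,4) U(4)] U(1,3)
        by (metis add.assoc card_atLeastLessThan diff_zero)
      have n: "real n > 0" using elim by simp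
      define a b m where "a = real (card A) / n" and "b = real (card N) / n" and "m = real (card M) / n"
      have abm: "real (card A) = a * n" "real (card N) = b * n" "real (card M) = m * n"
        "0 \<le> a" "0 \<le> b" "0 \<le> m"
        using n by (auto simp: a_def b_def m_def)
      have "(a + b + m) * n = real (card A + card N + card M)"
        using abm by (simp add: algebra_simps)
      then have sum1: "a + b + m = 1" using cards n by simp
      let ?e = "\<lambda>X Y. real (pair_count (adj G) X Y)"
      have eA: "?e A A \<le> \<delta> * real n ^ 2"
      proof (rule ccontr)
        assume "\<not> ?e A A \<le> \<delta> * real n ^ 2"
        then obtain P where P: "complete_parts (adj G) A 2 (card V) P"
          using elim(3)[rule_format, of A "adj G"] fin cards symp_adj[of G] by force
        have c': "proper_colouring E (\<lambda>v. if c v then 0 else 1 :: nat)"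
          using c by (auto simp: proper_colouring_def)
        have "subhypergraph V E {0..<n} G"
          using complete_parts_subhypergraph[OF H(1,2) c' _ P] An by (simp add: A_def)
        then show False using G by (simp add: avoiding_def)
      qed
      have eN: "?e N N \<le> \<delta> * real n ^ 2"
      proof (rule ccontr)
        assume "\<not> ?e N N \<le> \<delta> * real n ^ 2"
        then obtain P where P: "complete_parts (adj G) N 2 T P"
          using elim(4)[rule_format, of N "adj G"] fin cards symp_adj[of G] by force
        have ex: "\<exists>S' Y'. S' \<subseteq> P i \<and> card S' = card V \<and> Y' \<subseteq> A \<and> card Y' = card V \<and>
          (\<forall>x\<in>S'. \<forall>y\<in>Y'. adj G x y)" if "i < 2" for i
        proof (rule high_degree_common_neighbours[where n = n and T = T and \<epsilon> = \<delta>])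
          have Pi: "P i \<subseteq> N" "card (P i) = T" using P that by (auto simp: complete_parts_def)
          then show "finite (P i)" "card (P i) = T" using fin finite_subset by auto
          show "\<delta> * real n \<le> card {y\<in>A. adj G x y}" if "x \<in> P i" for x
            using Pi that by (auto simp: N_def)
        qed (use fin cards t T elim(1) in auto)
        obtain S0 Y0 where S0: "S0 \<subseteq> P 0" "card S0 = card V" "Y0 \<subseteq> A" "card Y0 = card V"
          "\<forall>x\<in>S0. \<forall>y\<in>Y0. adj G x y" using ex[of 0] by auto
        obtain S1 Y1 where S1: "S1 \<subseteq> P 1" "card S1 = card V" "Y1 \<subseteq> A" "card Y1 = card V"
          "\<forall>x\<in>S1. \<forall>y\<in>Y1. adj G x y" using ex[of 1] by auto
        have S01: "adj G x y" if "x \<in> S0" "y \<in> S1" for x y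
          using P[unfolded complete_parts_def, THEN conjunct2, rule_format, of 0 1 x y] S0(1) S1(1) that
          by auto
        have "P 0 \<subseteq> N" "P 1 \<subseteq> N" using P by (auto simp: complete_parts_def)
        then have Sn: "S0 \<subseteq> {0..<n}" "S1 \<subseteq> {0..<n}" using S0(1) S1(1) by (auto simp: N_def B_def)
        \<comment> \<open>\<open>Y0 - S0 - S1 - Y1\<close> is a blow-up of the closed path of length 4.\<close>
        define Q where "Q v = (if v \<in> singles E then (if c v then Y0 else Y1)
          else (if c v then S1 else S0))" for v
        have "subhypergraph V E {0..<n} G"
        proof (rule subhypergraph_blowup[OF H(1,2), where P = Q])
          show "adj G x y" if "u \<noteq> v" "{u, v} \<in> E" "x \<in> Q u" "y \<in> Q v" for u v x y
          proof -
            \<comment> \<open>The colours at the ends of an edge differ, and \<open>ind\<close>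
              excludes the pair \<open>Y0\<close>, \<open>Y1\<close>. The three remaining pairs are
              the consecutive ones.\<close>
            have uv: "adj E u v" using that by (simp add: adj_def)
            then have "c u \<noteq> c v" "\<not> (u \<in> singles E \<and> v \<in> singles E)"
              using c ind by (auto simp: proper_colouring_def)
            then show ?thesis using that(3,4) S0(5) S1(5) S01 sympD[OF symp_adj, of G]
              unfolding Q_def by (auto split: if_splits)
          qed
          show "Q v \<subseteq> singles G" if "{v} \<in> E" for v
            using that S0 S1 by (simp add: Q_def singles_def A_def)
          show "Q v \<subseteq> {0..<n} \<and> card V \<le> card (Q v)" for v
            using S0 S1 Sn An by (auto simp: Q_def)
        qed
        then show False using G by (simp add: avoiding_def)
      qed
      have eM: "?e M A \<le> \<delta> * real n ^ 2"
      proof -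
        have "?e M A = (\<Sum>x\<in>M. real (card {y\<in>A. adj G x y}))"
          by (simp add: pair_count_def)
        also have "\<dots> \<le> (\<Sum>x\<in>M. \<delta> * n)"
          by (rule sum_mono) (auto simp: M_def N_def)
        also have "\<dots> = card M * (\<delta> * n)" by simp
        also have "\<dots> \<le> n * (\<delta> * n)" using cards \<delta> by (intro mult_right_mono) auto
        finally show ?thesis by (simp add: power2_eq_square algebra_simps)
      qed
      have "?e {0..<n} {0..<n} = ?e A A + 2 * ?e B A + ?e B B"
        using pair_count_split[OF fin(1,2) U(2) symp_adj[of G]] U(1) by simp
      also have "?e B A = ?e N A + ?e M A"
        using pair_count_union_left[OF fin(3,4) U(4), of "adj G" A] U(3) by simp
      also have "?e B B = ?e N N + 2 * ?e M N + ?e M M"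
        using pair_count_split[OF fin(3,4) U(4) symp_adj[of G]] U(3) by simp
      also have "?e A A + 2 * (?e N A + ?e M A) + (?e N N + 2 * ?e M N + ?e M M) \<le>
         4 * (\<delta> * real n ^ 2) + 2 * (card N * card A) + 2 * (card M * card N) + card M * card M"
        using eA eN eM real_pair_count_le[OF fin(1), of "adj G" N]
          real_pair_count_le[OF fin(3), of "adj G" M] real_pair_count_le[OF fin(4), of "adj G" M]
        by simp
      also have "\<dots> = (2 * a * b + 2 * m * b + m ^ 2 + \<eta>) * real n ^ 2"
        by (simp add: abm \<delta>_def power2_eq_square algebra_simps)
      finally have "?e {0..<n} {0..<n} / real n ^ 2 \<le> 2 * a * b + 2 * m * b + m ^ 2 + \<eta>"
        using n by (simp add: field_simps)
      moreover have "real (card (singles G)) / n = a" by (simp add: a_def A_def)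
      ultimately show "real (card (singles G)) / n + ?e {0..<n} {0..<n} / real n ^ 2 \<le> 9 / 8 + \<eta>"
        using nine_eighths_bound[OF abm(4-6) sum1] by linarith
    qed
  qed
qed


section \<open>Lower bounds\<close>

definition pattern_graph :: "nat \<Rightarrow> nat set \<Rightarrow> (nat \<Rightarrow> nat \<Rightarrow> bool) \<Rightarrow> nat set set" where
  "pattern_graph n A R = (\<lambda>x. {x}) ` A \<union> {{x, y} | x y. x < n \<and> y < n \<and> x \<noteq> y \<and> R x y}"

lemma singles_pattern_graph: "singles (pattern_graph n A R) = A"
proof -
  have "{x} \<noteq> {y, z}" if "y \<noteq> z" for x y z :: nat using that by auto
  then show ?thesis by (auto simp: singles_def pattern_graph_def)
qed

lemma adj_pattern_graph:
  assumes "symp R"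
  shows "adj (pattern_graph n A R) x y \<longleftrightarrow> x < n \<and> y < n \<and> x \<noteq> y \<and> R x y"
  using sympD[OF assms] by (auto simp: adj_def pattern_graph_def doubleton_eq_iff)

lemma pattern_graph_wf:
  assumes "A \<subseteq> {0..<n}"
  shows "pattern_graph n A R \<subseteq> Pow {0..<n}" "edge_sizes (pattern_graph n A R) \<subseteq> {1, 2}"
  using assms by (auto simp: pattern_graph_def edge_sizes_def)

text \<open>The relation may hold on the diagonal, which makes its pairs easy to count; dropping the
  diagonal loses at most \<open>n\<close> of the \<open>n ^ 2\<close> pairs.\<close>

lemma hdens_pattern_graph:
  assumes A: "A \<subseteq> {0..<n}" and R: "symp R" and n: "2 \<le> n"
  shows "real (card A) / n + real (pair_count R {0..<n} {0..<n}) / real n ^ 2 - 1 / n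
    \<le> hdens n (pattern_graph n A R)"
proof -
  let ?G = "pattern_graph n A R"
  have "pair_count R {0..<n} {0..<n} \<le> (\<Sum>x\<in>{0..<n}. card {y\<in>{0..<n}. adj ?G x y} + 1)"
    unfolding pair_count_def
  proof (rule sum_mono)
    fix x assume "x \<in> {0..<n}"
    then have "{y\<in>{0..<n}. R x y} \<subseteq> insert x {y\<in>{0..<n}. adj ?G x y}"
      by (auto simp: adj_pattern_graph[OF R])
    then have "card {y\<in>{0..<n}. R x y} \<le> card (insert x {y\<in>{0..<n}. adj ?G x y})"
      by (intro card_mono) auto
    also have "\<dots> \<le> card {y\<in>{0..<n}. adj ?G x y} + 1"
      by (simp add: card_insert_if)
    finally show "card {y\<in>{0..<n}. R x y} \<le> card {y\<in>{0..<n}. adj ?G x y} + 1" .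
  qed
  also have "\<dots> = pair_count (adj ?G) {0..<n} {0..<n} + n"
    by (simp only: pair_count_def sum.distrib) simp
  finally have "real (pair_count R {0..<n} {0..<n}) \<le> real (pair_count (adj ?G) {0..<n} {0..<n} + n)"
    by (simp only: of_nat_le_iff)
  then have "real (pair_count R {0..<n} {0..<n}) / real n ^ 2 \<le>
      (real (pair_count (adj ?G) {0..<n} {0..<n}) + n) / real n ^ 2"
    by (intro divide_right_mono) auto
  also have "\<dots> = real (pair_count (adj ?G) {0..<n} {0..<n}) / real n ^ 2 + 1 / n"
    using n by (simp add: field_simps power2_eq_square)
  finally show ?thesis
    using hdens_ge[OF pattern_graph_wf[OF A] n, of R] by (simp add: singles_pattern_graph)
qed

text \<open>Only the homomorphism underlying an embedding is kept, so that avoidance can be shown by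
  excluding homomorphisms into the pattern.\<close>

lemma subhypergraph_pattern_graphD:
  assumes "subhypergraph V E U (pattern_graph n A R)" "hypergraph V E" "symp R"
  shows "\<exists>f. (\<forall>v\<in>singles E. f v \<in> A) \<and> (\<forall>u v. adj E u v \<longrightarrow> R (f u) (f v))"
proof -
  let ?G = "pattern_graph n A R"
  obtain f where f: "inj_on f V" "\<And>F. F \<in> E \<Longrightarrow> f ` F \<in> ?G"
    using assms(1) by (auto simp: subhypergraph_def)
  have "f v \<in> A" if "v \<in> singles E" for v
  proof -
    have "f v \<in> singles ?G" using f(2)[of "{v}"] that by (simp add: singles_def)
    then show ?thesis by (simp add: singles_pattern_graph)
  qed
  moreover have "R (f u) (f v)" if uv: "adj E u v" for u v
  proof -
    have "u \<in> V" "v \<in> V" using uv assms(2) by (auto simp: adj_def hypergraph_def)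
    then have "f u \<noteq> f v" using f(1) uv by (auto simp: adj_def inj_on_def)
    then have "adj ?G (f u) (f v)" using f(2)[of "{u, v}"] uv by (simp add: adj_def)
    then show ?thesis by (simp add: adj_pattern_graph[OF assms(3)])
  qed
  ultimately show ?thesis by blast
qed

lemma avoiding_pattern_graph:
  assumes "hypergraph V E" "symp R" "A \<subseteq> {0..<n}"
    and "\<And>f. (\<And>v. v \<in> singles E \<Longrightarrow> f v \<in> A) \<Longrightarrow> (\<And>u v. adj E u v \<Longrightarrow> R (f u) (f v)) \<Longrightarrow> False"
  shows "avoiding V E n (pattern_graph n A R)"
proof -
  have "\<not> subhypergraph V E {0..<n} (pattern_graph n A R)"
    using subhypergraph_pattern_graphD[OF _ assms(1,2)] assms(4) by metis
  then show ?thesis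
    using pattern_graph_wf[OF assms(3)] by (simp add: avoiding_def)
qed

text \<open>The constant \<open>C\<close> collects the rounding errors of a construction; the
  diagonal contributes one more \<open>1 / n\<close>.\<close>

lemma eventually_pattern_lower_bound:
  fixes A :: "nat \<Rightarrow> nat set" and C L \<eta> :: real
  assumes H: "hypergraph V E" and R: "\<And>n. symp (R n)" and A: "\<And>n. A n \<subseteq> {0..<n}"
    and no: "\<And>n f. (\<And>v. v \<in> singles E \<Longrightarrow> f v \<in> A n) \<Longrightarrow> (\<And>u v. adj E u v \<Longrightarrow> R n (f u) (f v)) \<Longrightarrow> False"
    and L: "\<And>n. 2 \<le> n \<Longrightarrow>
      L - C / n \<le> real (card (A n)) / n + real (pair_count (R n) {0..<n} {0..<n}) / real n ^ 2"
    and \<eta>: "0 < \<eta>"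
  shows "\<forall>\<^sub>F n in sequentially. \<exists>G. avoiding V E n G \<and> L - \<eta> \<le> hdens n G"
proof -
  have "\<forall>\<^sub>F n in sequentially. C + 1 \<le> \<eta> * real n" by (rule eventually_nat_ge_real[OF \<eta>])
  moreover have "\<forall>\<^sub>F n in sequentially. (2::nat) \<le> n" by (rule eventually_ge_at_top)
  ultimately show ?thesis
  proof eventually_elim
    case (elim n)
    have "(C + 1) / n \<le> \<eta>" using elim by (simp add: field_simps)
    then have "C / n + 1 / n \<le> \<eta>" by (simp add: add_divide_distrib)
    then have "L - \<eta> \<le> hdens n (pattern_graph n (A n) (R n))"
      using hdens_pattern_graph[OF A R[of n] elim(2)] L[OF elim(2)] by linarith
    moreover have "avoiding V E n (pattern_graph n (A n) (R n))"
      by (rule avoiding_pattern_graph[OF H R A]) (rule no[of _ n])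
    ultimately show ?case by blast
  qed
qed

section \<open>The extremal constructions\<close>

lemma lower_bound_Turan:
  fixes s :: nat and \<eta> :: real
  assumes H: "hypergraph V E" and s: "1 \<le> s"
    and no: "\<And>c :: 'a \<Rightarrow> nat. proper_colouring E c \<Longrightarrow> (\<And>v. c v < s) \<Longrightarrow> False"
    and \<eta>: "0 < \<eta>"
  shows "\<forall>\<^sub>F n in sequentially. \<exists>G. avoiding V E n G \<and> 2 - 1 / real s - \<eta> \<le> hdens n G"
proof (rule eventually_pattern_lower_bound[where A = "\<lambda>n. {0..<n}" and C = 1
      and R = "\<lambda>_ x y. x mod s \<noteq> y mod s", OF H])
  fix n :: nat assume n: "2 \<le> n"
  have "real n * (real n - real n / real s - 1) \<le>
     real (pair_count (\<lambda>x y. x mod s \<noteq> y mod s) {0..<n} {0..<n})"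
  proof -
    have "real n - real n / real s - 1 \<le> real (card {y\<in>{0..<n}. x mod s \<noteq> y mod s})" for x
    proof -
      \<comment> \<open>The Turan classes are the residue classes modulo \<open>s\<close>. An
        element of a class is determined by its quotient, which takes at most
        \<open>n div s + 1\<close> values.\<close>
      let ?S = "{y\<in>{0..<n}. x mod s = y mod s}"
      have "?S \<subseteq> (\<lambda>q. s * q + x mod s) ` {0..n div s}"
      proof
        fix y assume y: "y \<in> ?S"
        then have "y = s * (y div s) + x mod s" by simp
        moreover have "y div s \<le> n div s" using y by (intro div_le_mono) simp
        ultimately show "y \<in> (\<lambda>q. s * q + x mod s) ` {0..n div s}" by auto
      qed
      then have "card ?S \<le> n div s + 1"
        using card_mono[of "(\<lambda>q. s * q + x mod s) ` {0..n div s}" ?S]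
          card_image_le[of "{0..n div s}" "\<lambda>q. s * q + x mod s"] by simp
      then have "real (card ?S) \<le> real n / real s + 1"
        using of_nat_div_le_of_nat[where 'a = real, of n s] by linarith
      moreover have "card {0..<n} = card ?S + card {y\<in>{0..<n}. x mod s \<noteq> y mod s}"
      proof -
        have "{0..<n} = ?S \<union> {y\<in>{0..<n}. x mod s \<noteq> y mod s}" by auto
        then have "card {0..<n} = card (?S \<union> {y\<in>{0..<n}. x mod s \<noteq> y mod s})" by (rule arg_cong)
        also have "\<dots> = card ?S + card {y\<in>{0..<n}. x mod s \<noteq> y mod s}"
          by (rule card_Un_disjoint) auto
        finally show ?thesis .
      qed
      ultimately show ?thesis by simp
    qed
    then have "(\<Sum>x\<in>{0..<n}. real n - real n / real s - 1) \<le>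
        (\<Sum>x\<in>{0..<n}. real (card {y\<in>{0..<n}. x mod s \<noteq> y mod s}))"
      by (intro sum_mono) auto
    then show ?thesis by (simp add: pair_count_def)
  qed
  then have "real n * (real n - real n / real s - 1) / real n ^ 2 \<le>
     real (pair_count (\<lambda>x y. x mod s \<noteq> y mod s) {0..<n} {0..<n}) / real n ^ 2"
    by (rule divide_right_mono) simp
  moreover have "real n * (real n - real n / real s - 1) / real n ^ 2 = 1 - 1 / real s - 1 / n"
    using n s by (simp add: field_simps power2_eq_square)
  ultimately show "2 - 1 / real s - 1 / real n \<le> real (card {0..<n}) / n +
     real (pair_count (\<lambda>x y. x mod s \<noteq> y mod s) {0..<n} {0..<n}) / real n ^ 2"
    using n by simp
next
  fix n and f :: "'a \<Rightarrow> nat"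
  assume "\<And>u v. adj E u v \<Longrightarrow> f u mod s \<noteq> f v mod s"
  \<comment> \<open>Reducing the images modulo \<open>s\<close> gives a proper colouring with
    \<open>s\<close> colours.\<close>
  then show False
    using no[of "\<lambda>v. f v mod s"] s by (auto simp: proper_colouring_def)
qed (use \<eta> in \<open>auto simp: symp_def\<close>)

lemma div_ratio_bounds:
  fixes p q n :: nat
  assumes "2 \<le> n" "1 \<le> q"
  shows "\<bar>real (p * n div q) / n - real p / q\<bar> \<le> 1 / n"
proof -
  have "\<bar>real (p * n div q) - real (p * n) / q\<bar> \<le> 1"
  proof -
    define d where "d = p * n div q"
    have "p * n = q * d + p * n mod q" "p * n mod q < q" using assms by (auto simp: d_def)
    then have "p * n \<le> q * (d + 1)" by simp
    then have "real (p * n) \<le> real (q * (d + 1))" by (simp only: of_nat_le_iff)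
    then have "real (p * n) / q \<le> real d + 1" using assms by (simp add: field_simps)
    moreover have "real d \<le> real (p * n) / q" unfolding d_def by (rule of_nat_div_le_of_nat)
    ultimately show ?thesis unfolding d_def by linarith
  qed
  then have "\<bar>real (p * n div q) - real (p * n) / q\<bar> / n \<le> 1 / n"
    by (intro divide_right_mono) auto
  moreover have "\<bar>real (p * n div q) - real (p * n) / q\<bar> / n = \<bar>(real (p * n div q) - real (p * n) / q) / n\<bar>"
    by simp
  moreover have "(real (p * n div q) - real (p * n) / q) / n = real (p * n div q) / n - real p / q"
    using assms by (simp add: field_simps)
  ultimately show ?thesis by (simp only:)
qed

text \<open>The two 1-edges joined by a 2-edge would both be mapped into \<open>A\<close>, where no
  pair is present.\<close>

lemma lower_bound_five_quarters:
  fixes \<eta> :: real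
  assumes H: "hypergraph V E" and uv: "adj E u v" "u \<in> singles E" "v \<in> singles E" and \<eta>: "0 < \<eta>"
  shows "\<forall>\<^sub>F n in sequentially. \<exists>G. avoiding V E n G \<and> 5 / 4 - \<eta> \<le> hdens n G"
proof (rule eventually_pattern_lower_bound[where A = "\<lambda>n. {0..<n div 2}" and C = 1
      and R = "\<lambda>n x y. \<not> (x < n div 2 \<and> y < n div 2)", OF H])
  fix n :: nat assume n: "2 \<le> n"
  define h where "h = n div 2"
  let ?R = "\<lambda>x y. \<not> (x < h \<and> y < h)"
  have "{y\<in>{0..<n}. ?R x y} = (if x < h then {h..<n} else {0..<n})" for x by auto
  then have "pair_count ?R {0..<n} {0..<n} = (\<Sum>x\<in>{0..<n}. if x < h then n - h else n)"
    unfolding pair_count_def by (intro sum.cong) auto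
  also have "\<dots> = h * (n - h) + (n - h) * n"
  proof -
    have "{0..<n} \<inter> {x. x < h} = {0..<h}" "{0..<n} \<inter> - {x. x < h} = {h..<n}"
      by (auto simp: h_def)
    then show ?thesis by (simp add: sum.If_cases)
  qed
  finally have pc: "pair_count ?R {0..<n} {0..<n} = h * (n - h) + (n - h) * n" .
  have "real (pair_count ?R {0..<n} {0..<n}) = real n ^ 2 - real h ^ 2"
  proof -
    have "h \<le> n" by (simp add: h_def)
    then show ?thesis
      by (simp only: pc of_nat_add of_nat_mult of_nat_diff)
        (simp add: power2_eq_square algebra_simps)
  qed
  then have "real (pair_count ?R {0..<n} {0..<n}) / real n ^ 2 = 1 - (real h / n) ^ 2"
    using n by (simp add: field_simps power_divide)
  \<comment> \<open>The right side falls short of \<open>5 / 4\<close> by the square of the rounding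
    error of \<open>h / n\<close> from \<open>1 / 2\<close>.\<close>
  moreover have "5 / 4 - 1 / n \<le> real h / n + (1 - (real h / n) ^ 2)"
  proof -
    have "\<bar>real h / n - 1 / 2\<bar> \<le> 1 / n"
      using div_ratio_bounds[OF n, of 2 1] by (simp add: h_def)
    then have "(real h / n - 1 / 2) ^ 2 \<le> (1 / n) ^ 2"
      by (metis abs_ge_zero power2_abs power_mono)
    also have "\<dots> \<le> 1 / n" using n by (simp add: field_simps power2_eq_square)
    finally show ?thesis by (simp add: power2_eq_square algebra_simps)
  qed
  ultimately show "5 / 4 - 1 / real n \<le> real (card {0..<n div 2}) / n +
     real (pair_count (\<lambda>x y. \<not> (x < n div 2 \<and> y < n div 2)) {0..<n} {0..<n}) / real n ^ 2"
    by (simp add: h_def)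
next
  fix n and f :: "'a \<Rightarrow> nat"
  assume "\<And>v. v \<in> singles E \<Longrightarrow> f v \<in> {0..<n div 2}"
    "\<And>u v. adj E u v \<Longrightarrow> \<not> (f u < n div 2 \<and> f v < n div 2)"
  then show False using uv by fastforce
qed (use \<eta> in \<open>auto simp: symp_def\<close>)

text \<open>A walk in the bipartite pattern alternates between \<open>A\<close> and its complement.
  After an odd number of steps from \<open>A\<close> it is outside \<open>A\<close>, so the two ends
  cannot both be 1-edges.\<close>

lemma lower_bound_nine_eighths:
  fixes \<eta> :: real
  assumes H: "hypergraph V E" and p: "\<And>i. Suc i < 2 * k \<Longrightarrow> adj E (p i) (p (Suc i))" "1 \<le> k"
    and ends: "p 0 \<in> singles E" "p (2 * k - 1) \<in> singles E" and \<eta>: "0 < \<eta>"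
  shows "\<forall>\<^sub>F n in sequentially. \<exists>G. avoiding V E n G \<and> 9 / 8 - \<eta> \<le> hdens n G"
proof (rule eventually_pattern_lower_bound[where A = "\<lambda>n. {0..<3 * n div 4}" and C = 2
      and R = "\<lambda>n x y. x < 3 * n div 4 \<longleftrightarrow> \<not> y < 3 * n div 4", OF H])
  fix n :: nat assume n: "2 \<le> n"
  define h where "h = 3 * n div 4"
  let ?R = "\<lambda>x y. x < h \<longleftrightarrow> \<not> y < h"
  have hn: "h \<le> n" by (simp add: h_def)
  have "{y\<in>{0..<n}. ?R x y} = (if x < h then {h..<n} else {0..<h})" for x using hn by auto
  then have "pair_count ?R {0..<n} {0..<n} = (\<Sum>x\<in>{0..<n}. if x < h then n - h else h)"
    unfolding pair_count_def by (intro sum.cong) auto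
  also have "\<dots> = h * (n - h) + (n - h) * h"
  proof -
    have "{0..<n} \<inter> {x. x < h} = {0..<h}" "{0..<n} \<inter> - {x. x < h} = {h..<n}"
      using hn by auto
    then show ?thesis by (simp add: sum.If_cases)
  qed
  finally have "real (pair_count ?R {0..<n} {0..<n}) = 2 * real h * (real n - real h)"
    using hn by (simp only: of_nat_add of_nat_mult of_nat_diff) (simp add: algebra_simps)
  then have "real (pair_count ?R {0..<n} {0..<n}) / real n ^ 2 = 2 * (real h / n) * (1 - real h / n)"
    using n by (simp add: field_simps power2_eq_square)
  moreover have "9 / 8 - 2 / n \<le> real h / n + 2 * (real h / n) * (1 - real h / n)"
  proof -
    have "\<bar>real h / n - 3 / 4\<bar> \<le> 1 / n"
      using div_ratio_bounds[OF n, of 4 3] by (simp add: h_def)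
    then have "(real h / n - 3 / 4) ^ 2 \<le> (1 / n) ^ 2"
      by (metis abs_ge_zero power2_abs power_mono)
    also have "\<dots> \<le> 1 / n" using n by (simp add: field_simps power2_eq_square)
    finally have "2 * (real h / n - 3 / 4) ^ 2 \<le> 2 / n" by simp
    \<comment> \<open>Completing the square shows the choice of the share \<open>3/4\<close> for
      \<open>A\<close> to be optimal.\<close>
    moreover have "x + 2 * x * (1 - x) = 9 / 8 - 2 * (x - 3 / 4) ^ 2" for x :: real
      by (simp add: power2_eq_square algebra_simps)
    ultimately show ?thesis by smt
  qed
  ultimately show "9 / 8 - 2 / real n \<le> real (card {0..<3 * n div 4}) / n +
     real (pair_count (\<lambda>x y. x < 3 * n div 4 \<longleftrightarrow> \<not> y < 3 * n div 4) {0..<n} {0..<n}) / real n ^ 2"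
    by (simp add: h_def)
next
  fix n and f :: "'a \<Rightarrow> nat"
  assume f: "\<And>v. v \<in> singles E \<Longrightarrow> f v \<in> {0..<3 * n div 4}"
    "\<And>u v. adj E u v \<Longrightarrow> f u < 3 * n div 4 \<longleftrightarrow> \<not> f v < 3 * n div 4"
  have "i < 2 * k \<Longrightarrow> f (p i) < 3 * n div 4 \<longleftrightarrow> even i" for i
  proof (induction i)
    case 0
    show ?case using f(1)[OF ends(1)] by simp
  next
    case (Suc i)
    then show ?case using f(2)[OF p(1)[of i]] by auto
  qed
  from this[of "2 * k - 1"] show False using f(1)[OF ends(2)] p(2) by auto
qed (use \<eta> in \<open>auto simp: symp_def\<close>)

lemma lower_bound_one:
  fixes \<eta> :: real
  assumes H: "hypergraph V E" and uv: "adj E u v" and \<eta>: "0 < \<eta>"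
  shows "\<forall>\<^sub>F n in sequentially. \<exists>G. avoiding V E n G \<and> 1 - \<eta> \<le> hdens n G"
  by (rule eventually_pattern_lower_bound[where A = "\<lambda>n. {0..<n}" and C = 0
      and R = "\<lambda>_ _ _. False", OF H]) (use uv \<eta> in \<open>auto simp: symp_def\<close>)


section \<open>Colourings and closed paths\<close>

lemma proper_colouring_iff:
  "(\<forall>F\<in>E. card F = 2 \<longrightarrow> (\<forall>x\<in>F. \<forall>y\<in>F. x \<noteq> y \<longrightarrow> c x \<noteq> c y)) \<longleftrightarrow> proper_colouring E c"
proof (intro iffI ballI impI)
  fix F x y assume "proper_colouring E c" and F: "F \<in> E" "card F = 2" "x \<in> F" "y \<in> F" "x \<noteq> y"
  moreover have "F = {x, y}" using F by (auto simp: card_2_iff)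
  ultimately show "c x \<noteq> c y" by (auto simp: proper_colouring_def adj_def)
next
  assume *: "\<forall>F\<in>E. card F = 2 \<longrightarrow> (\<forall>x\<in>F. \<forall>y\<in>F. x \<noteq> y \<longrightarrow> c x \<noteq> c y)"
  show "proper_colouring E c"
    unfolding proper_colouring_def adj_def
  proof (intro allI impI, elim conjE)
    fix u v assume "u \<noteq> v" "{u, v} \<in> E"
    then show "c u \<noteq> c v" using *[rule_format, of "{u, v}" u v] by simp
  qed
qed

text \<open>The minimum is attained because an injective colouring of the finite set
  \<open>V\<close> shows that some number of colours suffices.\<close>

lemma chromatic_number2_colouring:
  assumes H: "hypergraph V E"
  shows "\<exists>c :: 'a \<Rightarrow> nat. (\<forall>x\<in>V. c x < chromatic_number2 V E) \<and> proper_colouring E c"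
proof -
  have "finite V" using H by (simp add: hypergraph_def)
  then obtain c :: "'a \<Rightarrow> nat" where "inj_on c V" "c ` V = {0..<card V}"
    using ex_bij_betw_finite_nat[of V] by (auto simp: bij_betw_def)
  then have "(\<forall>x\<in>V. c x < card V) \<and> proper_colouring E c"
    using H by (fastforce simp: proper_colouring_def adj_def hypergraph_def inj_on_def)
  then show ?thesis
    unfolding chromatic_number2_def proper_colouring_iff
    by (intro LeastI[of "\<lambda>k. \<exists>c :: 'a \<Rightarrow> nat. (\<forall>x\<in>V. c x < k) \<and> proper_colouring E c" "card V"]) blast
qed

lemma chromatic_number2_le:
  fixes c :: "'a \<Rightarrow> nat"
  assumes "proper_colouring E c" "\<And>v. v \<in> V \<Longrightarrow> c v < k"
  shows "chromatic_number2 V E \<le> k"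
  unfolding chromatic_number2_def proper_colouring_iff using assms by (intro Least_le) blast

section \<open>Even closed paths and the alignment of colours\<close>

lemma closed_path_subhypergraphD:
  assumes "subhypergraph (closed_path_V m) (closed_path_E m) V E"
  shows "\<exists>p. p 0 \<in> singles E \<and> p (m - 1) \<in> singles E \<and> (\<forall>i. Suc i < m \<longrightarrow> adj E (p i) (p (Suc i)))"
proof -
  obtain p where p: "inj_on p {0..<m}" "\<And>F. F \<in> closed_path_E m \<Longrightarrow> p ` F \<in> E"
    using assms by (auto simp: subhypergraph_def closed_path_V_def)
  have "adj E (p i) (p (Suc i))" if "Suc i < m" for i
  proof -
    have "p ` {i, Suc i} \<in> E" using that by (intro p(2)) (auto simp: closed_path_E_def)
    moreover have "p i \<noteq> p (Suc i)" using inj_onD[OF p(1), of i "Suc i"] that by auto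
    ultimately show ?thesis by (simp add: adj_def)
  qed
  moreover have "p ` {0} \<in> E" "p ` {m - 1} \<in> E"
    by (intro p(2); simp add: closed_path_E_def)+
  ultimately show ?thesis by (auto simp: singles_def)
qed

lemma closed_path_subhypergraphI:
  assumes "inj_on p {0..<m}" "p ` {0..<m} \<subseteq> V" "p 0 \<in> singles E" "p (m - 1) \<in> singles E"
    "\<And>i. Suc i < m \<Longrightarrow> adj E (p i) (p (Suc i))"
  shows "subhypergraph (closed_path_V m) (closed_path_E m) V E"
  unfolding subhypergraph_def closed_path_V_def
  using assms by (intro exI[of _ p]) (auto simp: closed_path_E_def singles_def adj_def)

text \<open>A shortest walk from \<open>u\<close> to \<open>w\<close> repeats no vertex. Colours
  alternate along it, so different end colours force an odd number of edges, that is, an even number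
  of vertices.\<close>

lemma closed_path_between_colour_classes:
  fixes c :: "'a \<Rightarrow> bool"
  assumes H: "hypergraph V E" and c: "proper_colouring E c"
    and uw: "u \<in> singles E" "w \<in> singles E" "(u, w) \<in> {(x, y). adj E x y}\<^sup>*" "c u \<noteq> c w"
  shows "\<exists>k\<ge>1. subhypergraph (closed_path_V (2 * k)) (closed_path_E (2 * k)) V E"
proof -
  let ?R = "{(x, y). adj E x y}"
  define n where "n = (LEAST n. (u, w) \<in> ?R ^^ n)"
  have "\<exists>n. (u, w) \<in> ?R ^^ n" using uw(3) by (rule rtrancl_imp_relpow)
  then have n: "(u, w) \<in> ?R ^^ n" unfolding n_def by (rule LeastI_ex)
  have least: "n \<le> l" if "(u, w) \<in> ?R ^^ l" for l
    unfolding n_def using that by (rule Least_le)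
  obtain p where p: "p 0 = u" "p n = w" "\<And>i. i < n \<Longrightarrow> (p i, p (Suc i)) \<in> ?R"
    using n unfolding relpow_fun_conv by blast
  have walk: "(p i, p (i + l)) \<in> ?R ^^ l" if "i + l \<le> n" for i l
    unfolding relpow_fun_conv using that p(3) by (intro exI[of _ "\<lambda>q. p (i + q)"]) auto
  have ne: "p i \<noteq> p j" if ij: "i < j" "j \<le> n" for i j
  proof
    assume eq: "p i = p j"
    \<comment> \<open>Cutting out the segment between two equal vertices would give a shorter
      walk.\<close>
    have "(u, p i) \<in> ?R ^^ i" using walk[of 0 i] p(1) ij by simp
    moreover have "(p i, w) \<in> ?R ^^ (n - j)" using walk[of j "n - j"] p(2) ij eq by simp
    ultimately have "(u, w) \<in> ?R ^^ (i + (n - j))" by (auto simp: relpow_add)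
    then show False using least[of "i + (n - j)"] ij by simp
  qed
  have col: "i \<le> n \<Longrightarrow> c (p i) = c u \<longleftrightarrow> even i" for i
  proof (induction i)
    case (Suc i)
    then have "adj E (p i) (p (Suc i))" using p(3)[of i] by simp
    then have "c (p i) \<noteq> c (p (Suc i))" using c by (auto simp: proper_colouring_def)
    then show ?case using Suc by auto
  qed (simp add: p(1))
  have "odd n" using col[of n] p(2) uw(4) by auto
  then obtain k where k: "n = 2 * k + 1" by (auto elim: oddE)
  \<comment> \<open>The walk has \<open>2 * k + 1\<close> edges, hence \<open>2 * (k + 1)\<close>
    vertices.\<close>
  have "subhypergraph (closed_path_V (2 * (k + 1))) (closed_path_E (2 * (k + 1))) V E"
  proof (rule closed_path_subhypergraphI[where p = p])
    show "inj_on p {0..<2 * (k + 1)}"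
    proof (rule inj_onI)
      fix i j assume "i \<in> {0..<2 * (k + 1)}" "j \<in> {0..<2 * (k + 1)}" "p i = p j"
      then show "i = j" using ne[of i j] ne[of j i] k by (cases i j rule: linorder_cases) auto
    qed
    show "p ` {0..<2 * (k + 1)} \<subseteq> V"
    proof
      fix x assume "x \<in> p ` {0..<2 * (k + 1)}"
      then obtain i where "i < 2 * (k + 1)" "x = p i" by auto
      then have i: "i \<le> n" "x = p i" using k by auto
      show "x \<in> V"
      proof (cases "i = n")
        case True
        then show ?thesis using i p(2) uw(2) H by (auto simp: singles_def hypergraph_def)
      next
        case False
        then have "adj E (p i) (p (Suc i))" using p(3)[of i] i by simp
        then show ?thesis using i H by (auto simp: adj_def hypergraph_def)
      qed
    qed
    show "p 0 \<in> singles E" "p (2 * (k + 1) - 1) \<in> singles E" using p uw k by auto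
    show "adj E (p i) (p (Suc i))" if "Suc i < 2 * (k + 1)" for i using p(3)[of i] that k by simp
  qed
  then show ?thesis by (intro exI[of _ "k + 1"]) simp
qed

text \<open>Without even closed paths, the 1-edges in one connected component all have the same
  colour. Flipping \<open>c\<close> on the components where this colour is the wrong one aligns them
  all.\<close>

lemma aligned_colouring:
  fixes c :: "'a \<Rightarrow> bool"
  assumes H: "hypergraph V E" and c: "proper_colouring E c"
    and no: "\<not> (\<exists>k\<ge>1. subhypergraph (closed_path_V (2 * k)) (closed_path_E (2 * k)) V E)"
  shows "\<exists>c' :: 'a \<Rightarrow> bool. proper_colouring E c' \<and> (\<forall>v\<in>singles E. c' v)"
proof -
  let ?R = "{(x, y). adj E x y}"
  have symR: "sym ?R" using symp_adj[of E] by (auto simp: sym_def symp_def)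
  have same: "c u = c w" if "u \<in> singles E" "w \<in> singles E" "(u, w) \<in> ?R\<^sup>*" for u w
    using closed_path_between_colour_classes[OF H c that] no by blast
  \<comment> \<open>\<open>S v\<close> holds the 1-edges in the component of \<open>v\<close>. Where
    there are any, \<open>c'\<close> records agreement with their common colour; elsewhere it is
    \<open>c\<close>.\<close>
  define S where "S v = {u \<in> singles E. (u, v) \<in> ?R\<^sup>*}" for v
  define c' where "c' v = (if S v = {} then c v else \<exists>u\<in>S v. c u = c v)" for v
  have Sc: "c u = c w" if "u \<in> S v" "w \<in> S v" for u w v
  proof -
    have "(v, w) \<in> ?R\<^sup>*" using that sym_rtrancl[OF symR] by (auto simp: S_def sym_def)
    then have "(u, w) \<in> ?R\<^sup>*" using that by (auto simp: S_def)
    then show ?thesis using same that by (auto simp: S_def)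
  qed
  have "c' x \<noteq> c' y" if xy: "adj E x y" for x y
  proof -
    have "(x, y) \<in> ?R" "(y, x) \<in> ?R" using xy symp_adj[of E] by (auto dest: sympD)
    then have "S x = S y" unfolding S_def by (auto intro: rtrancl_into_rtrancl)
    moreover have "c x \<noteq> c y" using xy c by (auto simp: proper_colouring_def)
    ultimately show ?thesis
    proof (cases "S y = {}")
      case False
      then obtain u where u: "u \<in> S y" by blast
      have "c' z \<longleftrightarrow> c u = c z" if z: "S z = S y" for z
      proof -
        have "c' z \<longleftrightarrow> (\<exists>w\<in>S y. c w = c z)" using False by (simp only: c'_def z if_False)
        also have "\<dots> \<longleftrightarrow> c u = c z" using Sc[OF u] u by metis
        finally show ?thesis .
      qed
      then show ?thesis using \<open>S x = S y\<close> \<open>c x \<noteq> c y\<close> by metis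
    qed (simp add: c'_def)
  qed
  moreover have "c' v" if "v \<in> singles E" for v
    using that by (auto simp: c'_def S_def)
  ultimately show ?thesis unfolding proper_colouring_def by blast
qed

section \<open>The limit in the four cases\<close>

theorem mainTheorem11:
  fixes V :: "'a set" and E :: "'a set set"
  assumes "hypergraph V E"
    and "edge_sizes E = {1, 2}"
  shows "(\<lambda>n. pi_n n V E) \<longlonglongrightarrow>
    (if \<not> bipartite2 V E then 2 - 1 / (real (chromatic_number2 V E) - 1)
     else if (\<exists>k\<ge>1. subhypergraph (closed_path_V (2*k)) (closed_path_E (2*k)) V E) then
       (if (LEAST k. k \<ge> 1 \<and> subhypergraph (closed_path_V (2*k)) (closed_path_E (2*k)) V E) = 1
        then 5/4 else 9/8)
     else 1)"
proof -
  note H = assms(1)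
  have sizes: "edge_sizes E \<subseteq> {1, 2}" using assms(2) by simp
  have "2 \<in> card ` E" using assms(2) by (auto simp: edge_sizes_def)
  then obtain F where "F \<in> E" "card F = 2" by auto
  then obtain u v where uv: "adj E u v" by (auto simp: card_2_iff adj_def)
  then have V: "V \<noteq> {}" using H by (auto simp: adj_def hypergraph_def)
  have bip: "bipartite2 V E \<longleftrightarrow> (\<exists>c :: 'a \<Rightarrow> bool. proper_colouring E c)"
    unfolding bipartite2_def proper_colouring_iff ..
  let ?path = "\<lambda>k. subhypergraph (closed_path_V (2*k)) (closed_path_E (2*k)) V E"
  show ?thesis
  proof (cases "bipartite2 V E")
    case False
    \<comment> \<open>\<open>H^2\<close> is colourable with \<open>s + 1\<close> colours but not
      with \<open>s\<close>; failing to be bipartite means \<open>s \<ge> 2\<close>.\<close>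
    define s where "s = chromatic_number2 V E - 1"
    obtain c :: "'a \<Rightarrow> nat" where c: "\<forall>x\<in>V. c x < chromatic_number2 V E" "proper_colouring E c"
      using chromatic_number2_colouring[OF H] by blast
    have "\<not> chromatic_number2 V E \<le> 2"
    proof
      assume "chromatic_number2 V E \<le> 2"
      then have c2: "c x < 2" if "x \<in> V" for x using c(1) that by fastforce
      have "proper_colouring E (\<lambda>x. c x = 0)"
        unfolding proper_colouring_def
      proof (intro allI impI)
        fix x y assume xy: "adj E x y"
        then have "x \<in> V" "y \<in> V" using H by (auto simp: adj_def hypergraph_def)
        moreover have "c x \<noteq> c y" using c(2) xy by (auto simp: proper_colouring_def)
        ultimately show "(c x = 0) \<noteq> (c y = 0)" using c2[of x] c2[of y] by linarith
      qed
      then show False using False bip by blast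
    qed
    then have s: "2 \<le> s" "chromatic_number2 V E = Suc s" by (auto simp: s_def)
    have "(\<lambda>n. pi_n n V E) \<longlonglongrightarrow> 2 - 1 / real s"
    proof (rule pi_n_tendsto[OF assms(2)])
      fix \<eta> :: real assume \<eta>: "0 < \<eta>"
      show "\<forall>\<^sub>F n in sequentially. \<forall>G. avoiding V E n G \<longrightarrow> real (card (singles G)) / n +
          real (pair_count (adj G) {0..<n} {0..<n}) / real n ^ 2 \<le> 2 - 1 / real s + \<eta>"
      proof (rule upper_bound_colourable[OF H sizes V c(2) _ _ _ \<eta>])
        fix a :: real assume a: "0 \<le> a" "a \<le> 1"
        \<comment> \<open>This product is \<open>s\<close> times the gap in the claimed bound. It is
          nonnegative since \<open>a \<le> 1 \<le> s - 1\<close>, so the maximum is at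
          \<open>a = 1\<close>.\<close>
        have "0 \<le> (1 - a) * (real s - 1 - a)" using a s by (intro mult_nonneg_nonneg) auto
        then have "(1 + a * real s) / real s \<le> (real s + a ^ 2) / real s"
          by (intro divide_right_mono) (auto simp: power2_eq_square algebra_simps)
        then show "a + 1 - a ^ 2 / real s \<le> 2 - 1 / real s"
          using s by (simp add: add_divide_distrib)
      qed (use c s in auto)
      show "\<forall>\<^sub>F n in sequentially. \<exists>G. avoiding V E n G \<and> 2 - 1 / real s - \<eta> \<le> hdens n G"
      proof (rule lower_bound_Turan[OF H _ _ \<eta>])
        fix c :: "'a \<Rightarrow> nat" assume "proper_colouring E c" "\<And>v. c v < s"
        then have "chromatic_number2 V E \<le> s" by (rule chromatic_number2_le)
        then show False using s by simp
      qed (use s in auto)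
    qed
    then show ?thesis using False s by simp
  next
    case True
    then obtain c :: "'a \<Rightarrow> bool" where c: "proper_colouring E c" using bip by blast
    show ?thesis
    proof (cases "\<exists>k\<ge>1. ?path k")
      case False
      obtain c' :: "'a \<Rightarrow> bool" where c': "proper_colouring E c'" "\<And>v. v \<in> singles E \<Longrightarrow> c' v"
        using aligned_colouring[OF H c False] by blast
      have "(\<lambda>n. pi_n n V E) \<longlonglongrightarrow> 1"
        using upper_bound_aligned[OF H sizes V c'] lower_bound_one[OF H uv]
        by (intro pi_n_tendsto[OF assms(2)]) auto
      then show ?thesis using True False by (simp only: not_True_eq_False if_True if_False)
    next
      case ex: True
      let ?least = "LEAST k. k \<ge> 1 \<and> ?path k"
      have least: "?least \<ge> 1 \<and> ?path ?least" by (rule LeastI_ex[OF ex])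
      show ?thesis
      proof (cases "?least = 1")
        case one: True
        then have "?path 1" using least by simp
        from closed_path_subhypergraphD[OF this]
        obtain p where p0: "p 0 \<in> singles E" "p (2 * 1 - 1) \<in> singles E"
          "\<forall>i. Suc i < 2 * 1 \<longrightarrow> adj E (p i) (p (Suc i))" by blast
        have p: "p 0 \<in> singles E" "p 1 \<in> singles E" "adj E (p 0) (p 1)"
          using p0(1,2) p0(3)[rule_format, of 0] by simp_all
        have c': "proper_colouring E (\<lambda>v. if c v then 0 else 1 :: nat)"
          using c by (auto simp: proper_colouring_def)
        have "(\<lambda>n. pi_n n V E) \<longlonglongrightarrow> 5 / 4"
        proof (rule pi_n_tendsto[OF assms(2)])
          fix \<eta> :: real assume \<eta>: "0 < \<eta>"
          show "\<forall>\<^sub>F n in sequentially. \<forall>G. avoiding V E n G \<longrightarrow> real (card (singles G)) / n +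
              real (pair_count (adj G) {0..<n} {0..<n}) / real n ^ 2 \<le> 5 / 4 + \<eta>"
          proof (rule upper_bound_colourable[OF H sizes V c' _ _ _ \<eta>, of 1])
            fix a :: real
            show "a + 1 - a ^ 2 / real 1 \<le> 5 / 4"
              \<comment> \<open>The case \<open>r = 1\<close>, where the maximum lies at
                \<open>a = 1/2\<close>.\<close>
              using zero_le_power2[of "a - 1 / 2"] by (simp add: power2_eq_square algebra_simps)
          qed auto
          show "\<forall>\<^sub>F n in sequentially. \<exists>G. avoiding V E n G \<and> 5 / 4 - \<eta> \<le> hdens n G"
            by (rule lower_bound_five_quarters[OF H p(3,1,2) \<eta>])
        qed
        then show ?thesis using True ex one by (simp only: refl not_True_eq_False if_True if_False)
      next
        case not_one: False
        have "\<not> ?path 1" 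
        proof
          assume "?path 1"
          then have "?least \<le> 1" by (intro Least_le conjI order_refl)
          then show False using not_one least by linarith
        qed
        \<comment> \<open>Two 1-edges joined by a 2-edge form a closed path of length 2, which is
          the case \<open>k = 1\<close>.\<close>
        have ind: "v \<notin> singles E" if uv: "adj E u v" "u \<in> singles E" for u v
        proof
          assume v: "v \<in> singles E"
          have "?path 1"
          proof (rule closed_path_subhypergraphI[where p = "\<lambda>i. if i = 0 then u else v"])
            show "(\<lambda>i. if i = 0 then u else v) ` {0..<2 * 1} \<subseteq> V"
              using uv H by (auto simp: adj_def hypergraph_def)
          qed (use uv v in \<open>auto simp: inj_on_def adj_def\<close>)
          then show False using \<open>\<not> ?path 1\<close> by contradiction
        qed
        \<comment> \<open>For the lower bound any even closed path will do, since its parity alone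
          rules out an embedding.\<close>
        obtain k p where k: "1 \<le> k" and p: "p 0 \<in> singles E" "p (2 * k - 1) \<in> singles E"
          "\<And>i. Suc i < 2 * k \<Longrightarrow> adj E (p i) (p (Suc i))"
        proof -
          obtain k where k: "1 \<le> k" "?path k" using ex by (elim exE conjE)
          from closed_path_subhypergraphD[OF k(2)] show ?thesis using that[OF k(1)] by blast
        qed
        have "(\<lambda>n. pi_n n V E) \<longlonglongrightarrow> 9 / 8"
          using upper_bound_singles_independent[OF H sizes V c ind]
            lower_bound_nine_eighths[OF H p(3) k p(1,2)]
          by (intro pi_n_tendsto[OF assms(2)]) auto
        then show ?thesis using True ex not_one by (simp only: not_True_eq_False if_True if_False)
      qed
    qed
  qed
qed

end
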